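(* Let $c>0$ be an absolute constant and let $\mathcal{A}$ be an algorithm which, given query access to $f:\{-1,1\}^n\to\{-1,1\}$ and parameters $s\in\mathbb{N}$, $\varepsilon\in(0,1)$, accepts with high probability if $f$ is $\varepsilon$-close to a size-$s$ decision tree, and rejects with high probability if $f$ is $(c\varepsilon)$-far from all size-$s$ decision trees. Then there is an algorithm $\mathcal{B}$ which, given parameters $s'\in\mathbb{N}$ and $\varepsilon'\in(0,1)$ and query access to a function $g:\{-1,1\}^n\to\{-1,1\}$ computed by a size-$s'$ decision tree, makes $\mathrm{poly}(s',n,1/\varepsilon')$ calls to $\mathcal{A}$, each with parameters $s\le s'$ and $\varepsilon\ge\mathrm{poly}(1/s',\varepsilon')$, and with high probability outputs a decision tree that is $\varepsilon'$-close to $g$. Furthermore, the auxiliary computation performed by $\mathcal{B}$ (apart from the calls to $\mathcal{A}$) takes time $\mathrm{poly}(n,s',1/\varepsilon')$.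
   Context: Size of a decision tree = number of leaves. Two functions are $\varepsilon$-close if they disagree on at most an $\varepsilon$ fraction of uniformly random inputs in $\{-1,1\}^n$, and $\varepsilon$-far otherwise. *)

theory Defs
  imports "HOL-Probability.Probability"
begin

section \<open>Boolean functions and decision trees\<close>

text \<open>Points of $\{-1,1\}^n$ are lists of length \<open>n\<close>. A function on $\{-1,1\}^n$ is a function on lists;
  its values outside the cube are irrelevant.\<close>

type_synonym point = "real list"

definition cube :: "nat \<Rightarrow> point set" where
  "cube n = {x. length x = n \<and> set x \<subseteq> {-1, 1}}"

definition bool_fun :: "nat \<Rightarrow> (point \<Rightarrow> real) \<Rightarrow> bool" where
  "bool_fun n f \<longleftrightarrow> f \<in> cube n \<rightarrow> {-1, 1}"

datatype dtree = DLeaf real | DNode nat dtree dtree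

fun dt_eval :: "dtree \<Rightarrow> point \<Rightarrow> real" where
  "dt_eval (DLeaf b) x = b"
| "dt_eval (DNode i l r) x = (if x ! i = -1 then dt_eval l x else dt_eval r x)"

fun num_leaves :: "dtree \<Rightarrow> nat" where
  "num_leaves (DLeaf b) = 1"
| "num_leaves (DNode i l r) = num_leaves l + num_leaves r"

fun wf_dtree :: "nat \<Rightarrow> dtree \<Rightarrow> bool" where
  "wf_dtree n (DLeaf b) \<longleftrightarrow> b \<in> {-1, 1}"
| "wf_dtree n (DNode i l r) \<longleftrightarrow> i < n \<and> wf_dtree n l \<and> wf_dtree n r"

text \<open>A size-\<open>s\<close> decision tree is one with at most \<open>s\<close> leaves.\<close>

definition dtrees :: "nat \<Rightarrow> nat \<Rightarrow> dtree set" where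
  "dtrees n s = {T. wf_dtree n T \<and> num_leaves T \<le> s}"

definition computed_by_size :: "nat \<Rightarrow> nat \<Rightarrow> (point \<Rightarrow> real) \<Rightarrow> bool" where
  "computed_by_size n s g \<longleftrightarrow> (\<exists>T\<in>dtrees n s. \<forall>x\<in>cube n. g x = dt_eval T x)"

definition close :: "nat \<Rightarrow> real \<Rightarrow> (point \<Rightarrow> real) \<Rightarrow> (point \<Rightarrow> real) \<Rightarrow> bool" where
  "close n \<epsilon> f h \<longleftrightarrow> measure_pmf.prob (pmf_of_set (cube n)) {x. f x \<noteq> h x} \<le> \<epsilon>"

abbreviation far :: "nat \<Rightarrow> real \<Rightarrow> (point \<Rightarrow> real) \<Rightarrow> (point \<Rightarrow> real) \<Rightarrow> bool" where
  "far n \<epsilon> f h \<equiv> \<not> close n \<epsilon> f h"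

section \<open>The tester\<close>

text \<open>\<open>A n s \<epsilon> f\<close> is the distribution of the verdict (\<^const>\<open>True\<close> for accept) of the randomized
  algorithm \<open>A\<close>, run with parameters \<open>s\<close>, \<open>\<epsilon>\<close> and query access to \<open>f\<close> on $\{-1,1\}^n$. The
  algorithm is a black box. ``With high probability'' means with probability at least \<open>1 - \<delta>\<close>.\<close>

type_synonym tester = "nat \<Rightarrow> nat \<Rightarrow> real \<Rightarrow> (point \<Rightarrow> real) \<Rightarrow> bool pmf"

definition tolerant_tester :: "real \<Rightarrow> real \<Rightarrow> tester \<Rightarrow> bool" where
  "tolerant_tester c \<delta> A \<longleftrightarrow>
    (\<forall>n s \<epsilon> f. 0 < \<epsilon> \<and> \<epsilon> < 1 \<and> bool_fun n f \<longrightarrow>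
      ((\<exists>T\<in>dtrees n s. close n \<epsilon> f (dt_eval T)) \<longrightarrow> pmf (A n s \<epsilon> f) True \<ge> 1 - \<delta>) \<and>
      ((\<forall>T\<in>dtrees n s. far n (c * \<epsilon>) f (dt_eval T)) \<longrightarrow> pmf (A n s \<epsilon> f) False \<ge> 1 - \<delta>))"

section \<open>The model of computation for the learner\<close>

text \<open>Learners are programs of a small imperative language over binary trees with numbers at the
  leaves (a LISP-like WHILE language), where every instruction takes one unit of time.
  The only operations on numbers are addition, subtraction, halving and comparison, and literals
  are integers. Numbers are real only so that the parameter \<open>\<epsilon>'\<close> can be an input: after
  \<open>t\<close> steps each number is a combination of the inputs and 1 whose coefficients are dyadic
  rationals of bit length \<open>O(t)\<close>. As there is no multiplication, rounding or equality test on
  trees, unit cost is polynomially related to time on a Turing machine (for which the subtrees of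
  a value are shared).\<close>

datatype val = Num real | Cell val val

fun num :: "val \<Rightarrow> real" where
  "num (Num r) = r"
| "num (Cell u v) = 0"

type_synonym store = "nat \<Rightarrow> val"

datatype expr =
    Var nat | Lit int | MkCell expr expr | Head expr | Tail expr | IsCell expr
  | Plus expr expr | Minus expr expr | Half expr | Less expr expr

fun head :: "val \<Rightarrow> val" where
  "head (Cell u v) = u"
| "head (Num r) = Num 0"

fun tail :: "val \<Rightarrow> val" where
  "tail (Cell u v) = v"
| "tail (Num r) = Num 0"

fun is_cell :: "val \<Rightarrow> bool" where
  "is_cell (Cell u v) \<longleftrightarrow> True"
| "is_cell (Num r) \<longleftrightarrow> False"

fun vsize :: "val \<Rightarrow> nat" where
  "vsize (Num r) = 1"
| "vsize (Cell u v) = 1 + vsize u + vsize v"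

fun expr_val :: "expr \<Rightarrow> store \<Rightarrow> val" where
  "expr_val (Var x) \<sigma> = \<sigma> x"
| "expr_val (Lit k) \<sigma> = Num (of_int k)"
| "expr_val (MkCell a b) \<sigma> = Cell (expr_val a \<sigma>) (expr_val b \<sigma>)"
| "expr_val (Head a) \<sigma> = head (expr_val a \<sigma>)"
| "expr_val (Tail a) \<sigma> = tail (expr_val a \<sigma>)"
| "expr_val (IsCell a) \<sigma> = Num (of_bool (is_cell (expr_val a \<sigma>)))"
| "expr_val (Plus a b) \<sigma> = Num (num (expr_val a \<sigma>) + num (expr_val b \<sigma>))"
| "expr_val (Minus a b) \<sigma> = Num (num (expr_val a \<sigma>) - num (expr_val b \<sigma>))"
| "expr_val (Half a) \<sigma> = Num (num (expr_val a \<sigma>) / 2)"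
| "expr_val (Less a b) \<sigma> = Num (of_bool (num (expr_val a \<sigma>) < num (expr_val b \<sigma>)))"

definition holds :: "expr \<Rightarrow> store \<Rightarrow> bool" where
  "holds e \<sigma> \<longleftrightarrow> expr_val e \<sigma> \<noteq> Num 0"

text \<open>\<open>Query x e\<close> assigns to \<open>x\<close> the value of \<open>g\<close> at the point \<open>e\<close>. \<open>Flip x\<close> assigns a uniformly
  random sign to \<open>x\<close>. \<open>CallA x e\<^sub>1 e\<^sub>2 y P\<close> runs the tester with parameters \<open>s = e\<^sub>1\<close>, \<open>\<epsilon> = e\<^sub>2\<close> and
  assigns its verdict (1 or 0) to \<open>x\<close>; each query of the tester is answered by running the
  subroutine \<open>P\<close> from the current store with the query point in \<open>y\<close>, the answer being left
  in \<open>y\<close>.\<close>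

datatype instr =
    Assign nat expr
  | Query nat expr
  | If expr "instr list" "instr list"
  | While expr "instr list"
  | Flip nat
  | CallA nat expr expr nat "instr list"

fun enc_point :: "point \<Rightarrow> val" where
  "enc_point [] = Num 0"
| "enc_point (a # x) = Cell (Num a) (enc_point x)"

fun dec_point :: "val \<Rightarrow> point" where
  "dec_point (Num r) = []"
| "dec_point (Cell u v) = num u # dec_point v"

fun enc_dtree :: "dtree \<Rightarrow> val" where
  "enc_dtree (DLeaf b) = Num b"
| "enc_dtree (DNode i l r) = Cell (Num (real i)) (Cell (enc_dtree l) (enc_dtree r))"

text \<open>One step of a deterministic program with query access to \<open>g\<close>; the instructions still to be
  executed form a list. Subroutines are run in this way: the answer of an oracle has to be a
  function of the query, so coin flips and calls of the tester have no effect in them.\<close>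

fun dstep :: "nat \<Rightarrow> (point \<Rightarrow> real) \<Rightarrow> instr list \<times> store \<Rightarrow> instr list \<times> store" where
  "dstep n g ([], \<sigma>) = ([], \<sigma>)"
| "dstep n g (Assign x e # P, \<sigma>) = (P, \<sigma>(x := expr_val e \<sigma>))"
| "dstep n g (Query x e # P, \<sigma>) =
    (let p = dec_point (expr_val e \<sigma>) in (P, \<sigma>(x := Num (if p \<in> cube n then g p else 0))))"
| "dstep n g (If e P1 P2 # P, \<sigma>) = ((if holds e \<sigma> then P1 else P2) @ P, \<sigma>)"
| "dstep n g (While e P1 # P, \<sigma>) = ((if holds e \<sigma> then P1 @ [While e P1] else []) @ P, \<sigma>)"
| "dstep n g (Flip x # P, \<sigma>) = (P, \<sigma>)"
| "dstep n g (CallA x e1 e2 y P1 # P, \<sigma>) = (P, \<sigma>)"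

text \<open>The execution of the subroutine \<open>P\<close> on the query \<open>q\<close>, and the function on $\{-1,1\}^n$ to which the
  subroutine provides query access (meaningful where the subroutine halts).\<close>

definition sub_run ::
    "nat \<Rightarrow> (point \<Rightarrow> real) \<Rightarrow> nat \<Rightarrow> instr list \<Rightarrow> store \<Rightarrow> point \<Rightarrow> nat \<Rightarrow> instr list \<times> store" where
  "sub_run n g y P \<sigma> q t = (dstep n g ^^ t) (P, \<sigma>(y := enc_point q))"

definition sub_fun ::
    "nat \<Rightarrow> (point \<Rightarrow> real) \<Rightarrow> nat \<Rightarrow> instr list \<Rightarrow> store \<Rightarrow> point \<Rightarrow> real" where
  "sub_fun n g y P \<sigma> q =
    num (snd (sub_run n g y P \<sigma> q (LEAST t. fst (sub_run n g y P \<sigma> q t) = [])) y)"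

text \<open>The calls of the tester are logged in the configuration.\<close>

record call =
  call_s :: nat
  call_eps :: real
  call_var :: nat
  call_sub :: "instr list"
  call_store :: store

type_synonym config = "instr list \<times> store \<times> call list"

fun step :: "tester \<Rightarrow> nat \<Rightarrow> (point \<Rightarrow> real) \<Rightarrow> config \<Rightarrow> config pmf" where
  "step A n g (Flip x # P, \<sigma>, L) =
    map_pmf (\<lambda>b. (P, \<sigma>(x := Num b), L)) (pmf_of_set {-1, 1})"
| "step A n g (CallA x e1 e2 y P1 # P, \<sigma>, L) =
    (let s = nat \<lfloor>num (expr_val e1 \<sigma>)\<rfloor>; \<epsilon> = num (expr_val e2 \<sigma>);
         c = \<lparr>call_s = s, call_eps = \<epsilon>, call_var = y, call_sub = P1, call_store = \<sigma>\<rparr>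
     in map_pmf (\<lambda>acc. (P, \<sigma>(x := Num (of_bool acc)), c # L))
          (A n s \<epsilon> (sub_fun n g y P1 \<sigma>)))"
| "step A n g (P, \<sigma>, L) = return_pmf (let (P', \<sigma>') = dstep n g (P, \<sigma>) in (P', \<sigma>', L))"

text \<open>The learner finds \<open>n\<close>, \<open>s'\<close>, \<open>\<epsilon>'\<close> in the variables 0, 1, 2 and leaves its output in variable 0.\<close>

definition init_store :: "nat \<Rightarrow> nat \<Rightarrow> real \<Rightarrow> store" where
  "init_store n s \<epsilon> = (\<lambda>_. Num 0)(0 := Num (real n), 1 := Num (real s), 2 := Num \<epsilon>)"

definition run ::
    "tester \<Rightarrow> instr list \<Rightarrow> nat \<Rightarrow> nat \<Rightarrow> real \<Rightarrow> (point \<Rightarrow> real) \<Rightarrow> nat \<Rightarrow> config pmf" where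
  "run A B n s \<epsilon> g t =
    ((\<lambda>p. bind_pmf p (step A n g)) ^^ t) (return_pmf (B, init_store n s \<epsilon>, []))"

text \<open>Every run halts within time \<open>t\<close>, where a call of the tester counts as one step. Writing down the
  output counts as well; its size is bounded separately because a tree with shared
  subtrees can be much larger than the time needed to build it. The same bound applies to the
  time for answering any one query of a called tester.\<close>

definition runs_in_time ::
    "tester \<Rightarrow> instr list \<Rightarrow> nat \<Rightarrow> nat \<Rightarrow> real \<Rightarrow> (point \<Rightarrow> real) \<Rightarrow> nat \<Rightarrow> bool" where
  "runs_in_time A B n s \<epsilon> g t \<longleftrightarrow>
    (\<forall>(P, \<sigma>, L)\<in>set_pmf (run A B n s \<epsilon> g t).
      P = [] \<and> vsize (\<sigma> 0) \<le> t \<and>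
      (\<forall>a\<in>set L. \<forall>q\<in>cube n.
        fst (sub_run n g (call_var a) (call_sub a) (call_store a) q t) = []))"

text \<open>Every run makes at most \<open>m\<close> calls of the tester, each of them on a function
  $\{-1,1\}^n \to \{-1,1\}$ and with parameters at most \<open>s\<close> and in $[e, 1)$.\<close>

definition calls_bounded ::
    "tester \<Rightarrow> instr list \<Rightarrow> nat \<Rightarrow> nat \<Rightarrow> real \<Rightarrow> (point \<Rightarrow> real) \<Rightarrow> nat \<Rightarrow> nat \<Rightarrow> real \<Rightarrow> bool" where
  "calls_bounded A B n s \<epsilon> g t m e \<longleftrightarrow>
    (\<forall>(P, \<sigma>, L)\<in>set_pmf (run A B n s \<epsilon> g t).
      length L \<le> m \<and>
      (\<forall>a\<in>set L. call_s a \<le> s \<and> e \<le> call_eps a \<and> call_eps a < 1 \<and>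
        bool_fun n (sub_fun n g (call_var a) (call_sub a) (call_store a))))"

definition outputs_close_tree ::
    "nat \<Rightarrow> real \<Rightarrow> (point \<Rightarrow> real) \<Rightarrow> config \<Rightarrow> bool" where
  "outputs_close_tree n \<epsilon> g = (\<lambda>(P, \<sigma>, L).
    P = [] \<and> (\<exists>T. wf_dtree n T \<and> \<sigma> 0 = enc_dtree T \<and> close n \<epsilon> (dt_eval T) g))"

text \<open>Polynomial bounds, up to domination: every polynomial in \<open>n, s, 1/\<epsilon>\<close> is at most
  \<^term>\<open>poly_ub k n s \<epsilon>\<close> for some \<open>k\<close>, and every monomial in \<open>1/s, \<epsilon>\<close> with positive coefficient
  is at least \<^term>\<open>poly_lb k s \<epsilon>\<close> for some \<open>k > 0\<close> (where \<open>s \<ge> 1\<close> and \<open>0 < \<epsilon> < 1\<close>).\<close>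

definition poly_ub :: "nat \<Rightarrow> nat \<Rightarrow> nat \<Rightarrow> real \<Rightarrow> real" where
  "poly_ub k n s \<epsilon> = real k * (real n + real s + 1 / \<epsilon>) ^ k"

definition poly_lb :: "nat \<Rightarrow> nat \<Rightarrow> real \<Rightarrow> real" where
  "poly_lb k s \<epsilon> = (1 / real k) * ((1 / real s) * \<epsilon>) ^ k"

end

theory Submission
  imports Defs
begin

text \<open>If \<open>f\<close> is \<open>\<epsilon>\<close>-close to a size-\<open>s\<close> tree with root \<open>i\<close> and subtrees of sizes \<open>s1\<close> and \<open>s - s1\<close>, then
  both restrictions of \<open>f\<close> by \<open>i\<close> are \<open>2 * \<epsilon>\<close>-close to trees of these sizes. The learner tries all pairs
  \<open>(i, s1)\<close>, takes the first one that the tester accepts on both sides, and recurses. Each level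
  loses a constant factor in \<open>\<epsilon>\<close>, so the recursion is stopped at depth \<open>D = log (2 * s' / \<epsilon>')\<close>, where
  the total loss is polynomial; as the sizes add up to \<open>s'\<close>, the nodes cut off at depth \<open>D\<close> have total
  measure at most \<open>s' / 2 ^ D\<close>. If no pair is accepted, \<open>f\<close> is \<open>\<epsilon>\<close>-close to a constant, which a single
  random sample finds with probability \<open>1 - \<epsilon>\<close>. The verdicts of the tester are amplified by majority
  votes, and the error probabilities of all tests and samples are added up.\<close>

section \<open>Restrictions of functions on the cube\<close>

text \<open>Between \<epsilon> and \<open>c * \<epsilon>\<close> the tester promises nothing, so its
  verdicts there may be arbitrary. A task with parameter \<open>p\<close> is only kept
  \<open>p / 2\<close>-close to a tree of its size: a split of that tree is \<open>p\<close>-close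
  on both sides and may not be rejected, while any accepted pair is \<open>C * p\<close>-close on
  both sides, which is again at most half of the children's parameter \<open>2 ^ j * p\<close>
  because \<open>2 * C \<le> 2 ^ j\<close>. Accuracy holds with high probability, but time, number
  of calls and output size must be bounded on every run, also after wrong verdicts. Hence two kinds
  of invariants are carried along, and termination rests on a weight of the worklist that drops in
  every iteration whatever the verdicts are. The same weight measures the failure probability still
  to be spent. The language has no recursion, so the learner keeps an explicit worklist and a stack
  of finished trees.\<close>

lemma cube_0 [simp]: "cube 0 = {[]}"
  by (auto simp: cube_def)

lemma cube_Suc: "cube (Suc n) = (\<lambda>x. -1 # x) ` cube n \<union> (\<lambda>x. 1 # x) ` cube n"
  by (auto simp: cube_def length_Suc_conv)

lemma finite_cube [simp]: "finite (cube n)"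
  by (induction n) (auto simp: cube_Suc)

lemma sum_cube_Suc:
  "(\<Sum>x\<in>cube (Suc n). f x) = (\<Sum>x\<in>cube n. f (-1 # x)) + (\<Sum>x\<in>cube n. f (1 # x) :: real)"
  unfolding cube_Suc
  by (subst sum.union_disjoint) (auto simp: sum.reindex inj_on_def)

lemma card_cube: "card (cube n) = 2 ^ n"
proof -
  have "(\<Sum>x\<in>cube n. 1 :: real) = 2 ^ n"
    by (induction n) (simp_all add: sum_cube_Suc del: sum_constant)
  then have "real (card (cube n)) = real (2 ^ n)"
    by simp
  then show ?thesis
    by (simp only: of_nat_eq_iff)
qed

lemma cube_nonempty [simp]: "cube n \<noteq> {}"
  using card_cube[of n] by (metis card.empty power_not_zero zero_neq_numeral)

lemma length_cube: "x \<in> cube n \<Longrightarrow> length x = n"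
  by (simp add: cube_def)

lemma nth_cube: "x \<in> cube n \<Longrightarrow> i < n \<Longrightarrow> x ! i = -1 \<or> x ! i = 1"
  using nth_mem[of i x] unfolding cube_def by blast

lemma list_update_cube: "x \<in> cube n \<Longrightarrow> b \<in> {-1, 1} \<Longrightarrow> x[i := b] \<in> cube n"
  using set_update_subset_insert[of x i b] by (auto simp: cube_def)

section \<open>Probabilities on the cube and averaging over one coordinate\<close>

definition cube_prob :: "nat \<Rightarrow> (point \<Rightarrow> bool) \<Rightarrow> real" where
  "cube_prob n P = measure_pmf.prob (pmf_of_set (cube n)) {x. P x}"

lemma cube_prob_eq_sum: "cube_prob n P = (\<Sum>x\<in>cube n. of_bool (P x)) / 2 ^ n"
proof -
  have "cube n \<inter> {x. P x} = {x \<in> cube n. P x}"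
    by auto
  then show ?thesis
    by (simp add: cube_prob_def measure_pmf_of_set card_cube sum.inter_filter[symmetric] of_bool_def)
qed

lemma close_iff_cube_prob: "close n \<epsilon> f h \<longleftrightarrow> cube_prob n (\<lambda>x. f x \<noteq> h x) \<le> \<epsilon>"
  by (simp add: close_def cube_prob_def)

lemma cube_prob_le_1: "cube_prob n P \<le> 1"
  by (simp add: cube_prob_def)

lemma cube_prob_nonneg: "0 \<le> cube_prob n P"
  by (simp add: cube_prob_def)

lemma cube_prob_cong: "(\<And>x. x \<in> cube n \<Longrightarrow> P x \<longleftrightarrow> Q x) \<Longrightarrow> cube_prob n P = cube_prob n Q"
  unfolding cube_prob_eq_sum by (intro arg_cong2[where f = "(/)"] sum.cong) auto

lemma close_cong:
  "(\<And>x. x \<in> cube n \<Longrightarrow> f x = f' x) \<Longrightarrow> close n \<epsilon> f h \<longleftrightarrow> close n \<epsilon> f' h"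
  by (simp add: close_iff_cube_prob cong: cube_prob_cong)

lemma close_mono: "close n \<epsilon> f h \<Longrightarrow> \<epsilon> \<le> \<epsilon>' \<Longrightarrow> close n \<epsilon>' f h"
  by (simp add: close_def)

text \<open>Flipping coordinate \<open>i\<close> permutes the cube, and the two settings of that
  coordinate in \<open>x\<close> give exactly \<open>x\<close> and its flip, so summing over both
  settings counts every point twice.\<close>

lemma cube_prob_split:
  assumes i: "i < n"
  shows "cube_prob n P =
    (cube_prob n (\<lambda>x. P (x[i := -1])) + cube_prob n (\<lambda>x. P (x[i := 1]))) / 2"
proof -
  define p where "p x = (of_bool (P x) :: real)" for x
  define flip where "flip x = x[i := - (x ! i)]" for x :: point
  have flip: "flip x \<in> cube n" "flip (flip x) = x" if "x \<in> cube n" for x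
    using that i nth_cube[OF that i] list_update_cube[OF that, of 1 i] list_update_cube[OF that, of "-1" i]
    by (auto simp: flip_def length_cube)
  have "(\<Sum>x\<in>cube n. p (flip x)) = (\<Sum>x\<in>cube n. p x)"
    by (rule sum.reindex_bij_witness[of _ flip flip]) (auto simp: flip)
  moreover have "p (x[i := -1]) + p (x[i := 1]) = p x + p (flip x)" if "x \<in> cube n" for x
    using nth_cube[OF that i]
  proof
    assume "x ! i = -1"
    then show ?thesis
      using list_update_id[of x i] by (simp add: flip_def)
  next
    assume "x ! i = 1"
    then show ?thesis
      using list_update_id[of x i] by (simp add: flip_def)
  qed
  then have "(\<Sum>x\<in>cube n. p (x[i := -1]) + p (x[i := 1])) = (\<Sum>x\<in>cube n. p x + p (flip x))"
    by (intro sum.cong) auto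
  ultimately show ?thesis
    by (simp add: cube_prob_eq_sum p_def[symmetric] sum.distrib field_simps)
qed

text \<open>A restriction is a partial assignment, with 0 at the free variables.\<close>

definition fill :: "point \<Rightarrow> point \<Rightarrow> point" where
  "fill \<rho> x = map2 (\<lambda>a b. if a \<noteq> 0 then a else b) \<rho> x"

lemma fill_simps [simp]:
  "fill [] x = []"
  "fill (a # \<rho>) (b # x) = (if a \<noteq> 0 then a else b) # fill \<rho> x"
  by (simp_all add: fill_def)

definition restrictions :: "nat \<Rightarrow> point set" where
  "restrictions n = {\<rho>. length \<rho> = n \<and> set \<rho> \<subseteq> {-1, 0, 1}}"

lemma length_fill: "length (fill \<rho> x) = min (length \<rho>) (length x)"
  by (simp add: fill_def)

lemma nth_fill:
  "i < length \<rho> \<Longrightarrow> i < length x \<Longrightarrow> fill \<rho> x ! i = (if \<rho> ! i \<noteq> 0 then \<rho> ! i else x ! i)"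
  by (simp add: fill_def)

lemma fill_cube: "\<rho> \<in> restrictions n \<Longrightarrow> x \<in> cube n \<Longrightarrow> fill \<rho> x \<in> cube n"
proof (induction \<rho> arbitrary: x n)
  case (Cons a \<rho>)
  then obtain b y m where x: "x = b # y" "n = Suc m" "y \<in> cube m" "b \<in> {-1, 1}"
    by (cases x) (auto simp: restrictions_def cube_def)
  then have "fill \<rho> y \<in> cube m"
    using Cons by (auto simp: restrictions_def)
  then show ?case
    using Cons.prems x by (auto simp: restrictions_def cube_def)
qed (simp add: restrictions_def)

lemma fill_update_free:
  assumes "length \<rho> = n" "length x = n" "\<rho> ! i = 0" "b \<noteq> 0"
  shows "fill \<rho> (x[i := b]) = fill (\<rho>[i := b]) x"
proof (rule nth_equalityI)
  show "fill \<rho> (x[i := b]) ! j = fill (\<rho>[i := b]) x ! j" if "j < length (fill \<rho> (x[i := b]))" for j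
    using that assms by (cases "j = i") (simp_all add: length_fill nth_fill)
qed (simp add: length_fill)

lemma fill_update_fixed:
  assumes "length \<rho> = n" "length x = n" "\<rho> ! i \<noteq> 0" 
  shows "fill \<rho> (x[i := b]) = fill \<rho> x"
proof (rule nth_equalityI)
  show "fill \<rho> (x[i := b]) ! j = fill \<rho> x ! j" if "j < length (fill \<rho> (x[i := b]))" for j
    using that assms by (cases "j = i") (simp_all add: length_fill nth_fill)
qed (simp add: length_fill)

lemma fill_zeros: "length x = n \<Longrightarrow> fill (replicate n 0) x = x"
  by (auto intro!: nth_equalityI simp: length_fill nth_fill)

section \<open>Trees under restrictions\<close>

text \<open>A subtree may query \<open>i\<close> again below a node labelled \<open>i\<close>;
  hard-wiring the answer keeps it meaningful on the whole cube, where coordinate \<open>i\<close> is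
  no longer tied to the branch taken.\<close>

fun dt_fix :: "nat \<Rightarrow> real \<Rightarrow> dtree \<Rightarrow> dtree" where
  "dt_fix i b (DLeaf a) = DLeaf a"
| "dt_fix i b (DNode j l r) =
    (if j = i then (if b = -1 then dt_fix i b l else dt_fix i b r)
     else DNode j (dt_fix i b l) (dt_fix i b r))"

lemma dt_eval_fix: "i < length x \<Longrightarrow> dt_eval (dt_fix i b T) x = dt_eval T (x[i := b])"
  by (induction T) auto

lemma num_leaves_pos: "1 \<le> num_leaves T"
  by (induction T) auto

lemma num_leaves_fix: "num_leaves (dt_fix i b T) \<le> num_leaves T"
  by (induction T) auto

lemma wf_dtree_fix: "wf_dtree n T \<Longrightarrow> wf_dtree n (dt_fix i b T)"
  by (induction T) auto

definition tree_close :: "nat \<Rightarrow> nat \<Rightarrow> real \<Rightarrow> (point \<Rightarrow> real) \<Rightarrow> bool" where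
  "tree_close n s \<epsilon> f \<longleftrightarrow> (\<exists>T\<in>dtrees n s. close n \<epsilon> f (dt_eval T))"

lemma tree_close_mono: "tree_close n s \<epsilon> f \<Longrightarrow> \<epsilon> \<le> \<epsilon>' \<Longrightarrow> tree_close n s \<epsilon>' f"
  unfolding tree_close_def by (blast intro: close_mono)

lemma tree_close_cong:
  "(\<And>x. x \<in> cube n \<Longrightarrow> f x = f' x) \<Longrightarrow> tree_close n s \<epsilon> f \<longleftrightarrow> tree_close n s \<epsilon> f'"
  by (simp add: tree_close_def cong: close_cong)

text \<open>One of the two halves of the cube loses at most \<open>\<epsilon>\<close>, and both lose at most \<open>2 * \<epsilon>\<close>. At a
  root variable fixed by \<open>\<rho>\<close> the better subtree alone is as good as the tree, so one descends.\<close>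

lemma close_tree_split:
  assumes "\<rho> \<in> restrictions n" "wf_dtree n T" "num_leaves T \<le> s"
    and "close n \<epsilon> (\<lambda>x. g (fill \<rho> x)) (dt_eval T)"
  shows "(\<exists>b\<in>{-1, 1}. close n \<epsilon> (\<lambda>x. g (fill \<rho> x)) (\<lambda>_. b)) \<or>
    (\<exists>i s1. i < n \<and> \<rho> ! i = 0 \<and> 1 \<le> s1 \<and> s1 < s \<and>
      tree_close n s1 (2 * \<epsilon>) (\<lambda>x. g (fill (\<rho>[i := -1]) x)) \<and>
      tree_close n (s - s1) (2 * \<epsilon>) (\<lambda>x. g (fill (\<rho>[i := 1]) x)))"
  using assms(2-4)
proof (induction "num_leaves T" arbitrary: T rule: less_induct)
  case less
  have len: "length \<rho> = n"
    using assms(1) by (simp add: restrictions_def)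
  show ?case
  proof (cases T)
    case (DLeaf b)
    then have "b \<in> {-1, 1}" "dt_eval T = (\<lambda>_. b)"
      using less.prems by (auto simp: fun_eq_iff)
    then show ?thesis
      using less.prems(3) by metis
  next
    case (DNode i l r)
    have i: "i < n" and wf: "wf_dtree n l" "wf_dtree n r"
      using less.prems DNode by auto
    define el where "el = cube_prob n (\<lambda>x. g (fill \<rho> (x[i := -1])) \<noteq> dt_eval (dt_fix i (-1) l) x)"
    define er where "er = cube_prob n (\<lambda>x. g (fill \<rho> (x[i := 1])) \<noteq> dt_eval (dt_fix i 1 r) x)"
    have "cube_prob n (\<lambda>x. g (fill \<rho> x) \<noteq> dt_eval T x) = (el + er) / 2"
      unfolding el_def er_def
      by (subst cube_prob_split[OF i], intro arg_cong2[where f = "\<lambda>a b. (a + b) / 2"] cube_prob_cong)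
        (use i in \<open>auto simp: DNode dt_eval_fix length_cube\<close>)
    then have sum: "el + er \<le> 2 * \<epsilon>"
      using less.prems(3) by (simp add: close_iff_cube_prob)
    have nonneg: "0 \<le> el" "0 \<le> er"
      by (simp_all add: el_def er_def cube_prob_nonneg)
    have leaves: "num_leaves (dt_fix i (-1) l) \<le> num_leaves l" "num_leaves (dt_fix i 1 r) \<le> num_leaves r"
      "1 \<le> num_leaves l" "1 \<le> num_leaves r" "num_leaves T = num_leaves l + num_leaves r"
      using num_leaves_fix num_leaves_pos DNode by auto
    show ?thesis
    proof (cases "\<rho> ! i = 0")
      case True
      have "close n (2 * \<epsilon>) (\<lambda>x. g (fill (\<rho>[i := -1]) x)) (dt_eval (dt_fix i (-1) l))"
        using sum nonneg True len
        by (simp add: close_iff_cube_prob el_def fill_update_free length_cube cong: cube_prob_cong)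
      then have 1: "tree_close n (num_leaves l) (2 * \<epsilon>) (\<lambda>x. g (fill (\<rho>[i := -1]) x))"
        using wf leaves unfolding tree_close_def dtrees_def by (blast intro: wf_dtree_fix)
      have "close n (2 * \<epsilon>) (\<lambda>x. g (fill (\<rho>[i := 1]) x)) (dt_eval (dt_fix i 1 r))"
        using sum nonneg True len
        by (simp add: close_iff_cube_prob er_def fill_update_free length_cube cong: cube_prob_cong)
      \<comment> \<open>The right child is allowed all that the left one leaves, not just the leaves
        of \<open>r\<close>, so that the sizes of the two tasks add up to \<open>s\<close>.\<close>
      moreover have "dt_fix i 1 r \<in> dtrees n (s - num_leaves l)"
        using wf leaves less.prems by (simp add: dtrees_def wf_dtree_fix)
      ultimately have 2: "tree_close n (s - num_leaves l) (2 * \<epsilon>) (\<lambda>x. g (fill (\<rho>[i := 1]) x))"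
        unfolding tree_close_def by blast
      have "1 \<le> num_leaves l" "num_leaves l < s"
        using leaves less.prems by linarith+
      then show ?thesis
        using 1 2 i True by blast
    next
      case False
      have "el \<le> \<epsilon> \<or> er \<le> \<epsilon>"
        using sum by linarith
      then show ?thesis
      proof
        assume *: "el \<le> \<epsilon>"
        show ?thesis
        proof (rule less.hyps)
          \<comment> \<open>\<open>fill \<rho>\<close> ignores coordinate \<open>i\<close> here, so
            the error on this half is the error on the whole cube.\<close>
          show "close n \<epsilon> (\<lambda>x. g (fill \<rho> x)) (dt_eval (dt_fix i (-1) l))"
            using * False len
            by (simp add: close_iff_cube_prob el_def fill_update_fixed length_cube cong: cube_prob_cong)
        qed (use leaves wf less.prems in \<open>auto intro: wf_dtree_fix\<close>)
      next
        assume *: "er \<le> \<epsilon>"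
        show ?thesis
        proof (rule less.hyps)
          show "close n \<epsilon> (\<lambda>x. g (fill \<rho> x)) (dt_eval (dt_fix i 1 r))"
            using * False len
            by (simp add: close_iff_cube_prob er_def fill_update_fixed length_cube cong: cube_prob_cong)
        qed (use leaves wf less.prems in \<open>auto intro: wf_dtree_fix\<close>)
      qed
    qed
  qed
qed

text \<open>Below a free variable the two halves have equal measure, so the errors of the children
  average; if \<open>\<rho>\<close> fixed the variable, one child would never be evaluated.\<close>

lemma node_error:
  assumes \<rho>: "\<rho> \<in> restrictions n" and i: "i < n" "\<rho> ! i = 0"
  shows "cube_prob n (\<lambda>x. dt_eval (DNode i l r) (fill \<rho> x) \<noteq> g (fill \<rho> x)) =
    (cube_prob n (\<lambda>x. dt_eval l (fill (\<rho>[i := -1]) x) \<noteq> g (fill (\<rho>[i := -1]) x)) +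
     cube_prob n (\<lambda>x. dt_eval r (fill (\<rho>[i := 1]) x) \<noteq> g (fill (\<rho>[i := 1]) x))) / 2"
  by (subst cube_prob_split[OF i(1)], intro arg_cong2[where f = "\<lambda>a b. (a + b) / 2"] cube_prob_cong)
    (use assms in \<open>auto simp: fill_update_free[where n = n] restrictions_def length_cube nth_fill\<close>)

section \<open>Reasoning about programs\<close>

text \<open>Deterministic executions only: there are no rules for \<^const>\<open>Flip\<close> and \<^const>\<open>CallA\<close>.\<close>

inductive exec :: "nat \<Rightarrow> (point \<Rightarrow> real) \<Rightarrow> instr list \<Rightarrow> store \<Rightarrow> nat \<Rightarrow> store \<Rightarrow> bool"
  for n :: nat and g :: "point \<Rightarrow> real"
where
  exec_Nil: "exec n g [] \<sigma> 0 \<sigma>"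
| exec_Assign: "exec n g P (\<sigma>(x := expr_val e \<sigma>)) t \<sigma>' \<Longrightarrow> exec n g (Assign x e # P) \<sigma> (Suc t) \<sigma>'"
| exec_Query: "dec_point (expr_val e \<sigma>) \<in> cube n \<Longrightarrow>
    exec n g P (\<sigma>(x := Num (g (dec_point (expr_val e \<sigma>))))) t \<sigma>' \<Longrightarrow>
    exec n g (Query x e # P) \<sigma> (Suc t) \<sigma>'"
| exec_If: "exec n g ((if holds e \<sigma> then P1 else P2) @ P) \<sigma> t \<sigma>' \<Longrightarrow>
    exec n g (If e P1 P2 # P) \<sigma> (Suc t) \<sigma>'"
| exec_While_True: "holds e \<sigma> \<Longrightarrow> exec n g (P1 @ While e P1 # P) \<sigma> t \<sigma>' \<Longrightarrow>
    exec n g (While e P1 # P) \<sigma> (Suc t) \<sigma>'"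
| exec_While_False: "\<not> holds e \<sigma> \<Longrightarrow> exec n g P \<sigma> t \<sigma>' \<Longrightarrow> exec n g (While e P1 # P) \<sigma> (Suc t) \<sigma>'"

lemma exec_append:
  assumes "exec n g P \<sigma> t \<sigma>'" "exec n g Q \<sigma>' u \<sigma>''"
  shows "exec n g (P @ Q) \<sigma> (t + u) \<sigma>''"
  using assms by (induction rule: exec.induct) (auto intro: exec.intros)

lemma exec_dstep: "exec n g P \<sigma> t \<sigma>' \<Longrightarrow> (dstep n g ^^ t) (P, \<sigma>) = ([], \<sigma>')"
  by (induction rule: exec.induct) (simp_all add: funpow_Suc_right Let_def fun_upd_def del: funpow.simps(2))

lemma dstep_Nil: "(dstep n g ^^ t) ([], \<sigma>) = ([], \<sigma>)"
  by (induction t) auto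

lemma sub_run_exec:
  assumes "exec n g P (\<sigma>(y := enc_point q)) t \<sigma>'" "t \<le> u"
  shows "sub_run n g y P \<sigma> q u = ([], \<sigma>')"
proof -
  obtain d where "u = d + t"
    using assms(2) by (metis add.commute le_Suc_ex)
  then show ?thesis
    using exec_dstep[OF assms(1)] by (simp add: sub_run_def funpow_add dstep_Nil)
qed

text \<open>A halted configuration never changes again, so the store at the least halting time is
  the one found at any later time.\<close>

lemma sub_fun_exec:
  assumes "exec n g P (\<sigma>(y := enc_point q)) t \<sigma>'"
  shows "sub_fun n g y P \<sigma> q = num (\<sigma>' y)"
proof -
  define l where "l = (LEAST u. fst (sub_run n g y P \<sigma> q u) = [])"
  have t: "sub_run n g y P \<sigma> q t = ([], \<sigma>')"
    using sub_run_exec[OF assms] by simp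
  have "fst (sub_run n g y P \<sigma> q l) = []"
    unfolding l_def by (rule LeastI[of _ t]) (simp add: t)
  moreover have "l \<le> t"
    unfolding l_def by (rule Least_le) (simp add: t)
  then obtain d where "t = d + l"
    by (metis add.commute le_Suc_ex)
  then have "sub_run n g y P \<sigma> q t = (dstep n g ^^ d) (sub_run n g y P \<sigma> q l)"
    by (simp add: sub_run_def funpow_add)
  ultimately have "sub_run n g y P \<sigma> q l = sub_run n g y P \<sigma> q t"
    by (metis dstep_Nil prod.collapse)
  then show ?thesis
    using t by (simp add: sub_fun_def l_def)
qed

section \<open>Probabilistic executions: worst-case guarantees and error bounds\<close>

lemma prob_bind_bool:
  "measure_pmf.prob (bind_pmf M f) S =
     pmf M True * measure_pmf.prob (f True) S + pmf M False * measure_pmf.prob (f False) S"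
proof -
  have "emeasure (measure_pmf (bind_pmf M f)) S = (\<Sum>b\<in>UNIV. emeasure (measure_pmf (f b)) S * pmf M b)"
    unfolding emeasure_bind_pmf by (rule nn_integral_measure_pmf_support) auto
  then have "ennreal (measure_pmf.prob (bind_pmf M f) S) =
      ennreal (pmf M True * measure_pmf.prob (f True) S + pmf M False * measure_pmf.prob (f False) S)"
    by (simp add: UNIV_bool measure_pmf.emeasure_eq_measure ennreal_mult ennreal_plus mult.commute
        add.commute del: emeasure_bind_pmf)
  then show ?thesis
    by (subst (asm) ennreal_inj) auto
qed

text \<open>Presents a coin flip as a random Boolean, so that flips and verdicts of the tester fall
  under one branching rule.\<close>

lemma pmf_of_set_signs:
  "pmf_of_set {-1, 1 :: real} = map_pmf (\<lambda>b. if b then 1 else -1) (pmf_of_set UNIV)"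
  by (subst map_pmf_of_set_inj) (auto simp: inj_on_def UNIV_bool insert_commute)

locale execution =
  fixes A :: tester and n :: nat and g :: "point \<Rightarrow> real" and safe bad :: "config set"
begin

definition steps :: "nat \<Rightarrow> config pmf \<Rightarrow> config pmf" where
  "steps t = (\<lambda>M. bind_pmf M (step A n g)) ^^ t"

lemma steps_bind: "steps t (bind_pmf M f) = bind_pmf M (\<lambda>x. steps t (f x))"
  by (induction t) (simp_all add: steps_def bind_assoc_pmf)

text \<open>\<open>steps\<close> appends steps at the end, whereas programs are analysed from their
  first instruction; linearity in the initial distribution moves the first step to the
  front.\<close>

lemma steps_Suc_return:
  "steps (Suc t) (return_pmf C) = bind_pmf (step A n g C) (\<lambda>C'. steps t (return_pmf C'))"
proof -
  have "steps (Suc t) (return_pmf C) = steps t (step A n g C)"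
    by (simp add: steps_def funpow_Suc_right bind_return_pmf del: funpow.simps(2))
  also have "\<dots> = steps t (bind_pmf (step A n g C) return_pmf)"
    by (simp add: bind_return_pmf')
  finally show ?thesis
    by (simp only: steps_bind)
qed

text \<open>From \<open>C\<close> every run is halted and safe after \<open>T\<close> steps, and bad with probability at most \<open>p\<close>.\<close>

definition ensures :: "nat \<Rightarrow> real \<Rightarrow> config \<Rightarrow> bool" where
  "ensures T p C \<longleftrightarrow> (\<forall>t\<ge>T. set_pmf (steps t (return_pmf C)) \<subseteq> safe \<and>
    measure_pmf.prob (steps t (return_pmf C)) bad \<le> p)"

lemma ensures_mono: "ensures T p C \<Longrightarrow> T \<le> T' \<Longrightarrow> p \<le> p' \<Longrightarrow> ensures T' p' C"
  unfolding ensures_def by (meson order_trans)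

text \<open>Probabilities never exceed 1. This is the bound used once a verdict or a sample was
  wrong: nothing is claimed about the output any more, but the worst-case guarantees
  persist.\<close>

lemma ensures_one: "ensures T p C \<Longrightarrow> ensures T 1 C"
  unfolding ensures_def by simp

lemma ensures_Nil:
  assumes "([], \<sigma>, L) \<in> safe" "([], \<sigma>, L) \<in> bad \<longrightarrow> 1 \<le> p" "0 \<le> p"
  shows "ensures 0 p ([], \<sigma>, L)"
proof -
  have "steps t (return_pmf ([], \<sigma>, L)) = return_pmf ([], \<sigma>, L)" for t
    by (induction t) (simp_all add: steps_def bind_return_pmf)
  then show ?thesis
    using assms by (auto simp: ensures_def measure_return indicator_def)
qed

lemma ensures_return:
  assumes "step A n g C = return_pmf C'" "0 < T" "ensures (T - 1) p C'"
  shows "ensures T p C"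
  unfolding ensures_def
proof (intro allI impI)
  fix t assume "T \<le> t"
  then obtain u where "t = Suc u" "T - 1 \<le> u"
    using assms(2) by (cases t) auto
  then show "set_pmf (steps t (return_pmf C)) \<subseteq> safe \<and>
      measure_pmf.prob (steps t (return_pmf C)) bad \<le> p"
    using assms(3) by (simp add: steps_Suc_return assms(1) bind_return_pmf ensures_def)
qed

text \<open>The error bound \<open>q\<close> may depend on the outcome, and only its mean counts.
  This lets a potential function or the quality of a sample be carried through the run.\<close>

lemma ensures_branch:
  assumes "step A n g C = map_pmf h M" "\<And>b. ensures T (q b) (h b)"
    and "pmf M True * q True + pmf M False * q False \<le> p"
  shows "ensures (Suc T) p C"
  unfolding ensures_def
proof (intro allI impI)
  fix t assume "Suc T \<le> t"
  then obtain u where u: "t = Suc u" "T \<le> u"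
    by (cases t) auto
  let ?f = "\<lambda>b. steps u (return_pmf (h b))"
  have eq: "steps t (return_pmf C) = bind_pmf M ?f"
    by (simp add: u steps_Suc_return assms(1) map_pmf_def bind_assoc_pmf bind_return_pmf)
  have f: "set_pmf (?f b) \<subseteq> safe" "measure_pmf.prob (?f b) bad \<le> q b" for b
    using assms(2)[of b] u by (auto simp: ensures_def)
  have "measure_pmf.prob (bind_pmf M ?f) bad \<le> pmf M True * q True + pmf M False * q False"
    unfolding prob_bind_bool by (intro add_mono mult_left_mono f) auto
  then show "set_pmf (steps t (return_pmf C)) \<subseteq> safe \<and>
      measure_pmf.prob (steps t (return_pmf C)) bad \<le> p"
    using f(1) assms(3) by (auto simp: eq)
qed

lemma ensures_Flip:
  assumes "\<And>b. b \<in> {-1, 1} \<Longrightarrow> ensures T (q b) (P, \<sigma>(x := Num b), L)"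
  shows "ensures (Suc T) ((q (-1) + q 1) / 2) (Flip x # P, \<sigma>, L)"
proof (rule ensures_branch[where T = T and q = "\<lambda>b. q (if b then 1 else -1)"
      and M = "pmf_of_set UNIV" and h = "\<lambda>b. (P, \<sigma>(x := Num (if b then 1 else -1)), L)"])
  show "step A n g (Flip x # P, \<sigma>, L) =
      map_pmf (\<lambda>b. (P, \<sigma>(x := Num (if b then 1 else -1)), L)) (pmf_of_set UNIV)"
    by (simp add: pmf_of_set_signs map_pmf_comp)
qed (use assms in auto)

lemma ensures_CallA:
  assumes "\<And>b. ensures T (q b) (P, \<sigma>(x := Num (of_bool b)),
      \<lparr>call_s = s, call_eps = \<epsilon>, call_var = y, call_sub = P1, call_store = \<sigma>\<rparr> # L)"
    and "s = nat \<lfloor>num (expr_val e1 \<sigma>)\<rfloor>" "\<epsilon> = num (expr_val e2 \<sigma>)"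
    and "pmf (A n s \<epsilon> (sub_fun n g y P1 \<sigma>)) True * q True +
      pmf (A n s \<epsilon> (sub_fun n g y P1 \<sigma>)) False * q False \<le> p"
  shows "ensures (Suc T) p (CallA x e1 e2 y P1 # P, \<sigma>, L)"
  by (rule ensures_branch[OF _ assms(1) assms(4)]) (simp add: assms(2,3) Let_def)

lemma ensures_Assign: "0 < T \<Longrightarrow> ensures (T - 1) p (P, \<sigma>(x := expr_val e \<sigma>), L) \<Longrightarrow> ensures T p (Assign x e # P, \<sigma>, L)"
  by (rule ensures_return) auto

lemma ensures_If: "0 < T \<Longrightarrow> ensures (T - 1) p ((if holds e \<sigma> then P1 else P2) @ P, \<sigma>, L) \<Longrightarrow>
    ensures T p (If e P1 P2 # P, \<sigma>, L)"
  by (rule ensures_return) auto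

lemma ensures_Assign_less: "ensures T p (P, \<sigma>(x := expr_val e \<sigma>), L) \<Longrightarrow> T < T' \<Longrightarrow> ensures T' p (Assign x e # P, \<sigma>, L)"
  by (rule ensures_Assign) (auto elim: ensures_mono)

lemma ensures_If_less: "ensures T p ((if holds e \<sigma> then P1 else P2) @ P, \<sigma>, L) \<Longrightarrow> T < T' \<Longrightarrow>
    ensures T' p (If e P1 P2 # P, \<sigma>, L)"
  by (rule ensures_If) (auto elim: ensures_mono split del: if_split)

lemma ensures_Query: "0 < T \<Longrightarrow> dec_point (expr_val e \<sigma>) \<in> cube n \<Longrightarrow>
    ensures (T - 1) p (P, \<sigma>(x := Num (g (dec_point (expr_val e \<sigma>)))), L) \<Longrightarrow> ensures T p (Query x e # P, \<sigma>, L)"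
  by (rule ensures_return) (auto simp: Let_def)

lemma ensures_While_True: "0 < T \<Longrightarrow> holds e \<sigma> \<Longrightarrow> ensures (T - 1) p (P1 @ While e P1 # P, \<sigma>, L) \<Longrightarrow>
    ensures T p (While e P1 # P, \<sigma>, L)"
  by (rule ensures_return) auto

lemma ensures_While_False: "0 < T \<Longrightarrow> \<not> holds e \<sigma> \<Longrightarrow> ensures (T - 1) p (P, \<sigma>, L) \<Longrightarrow>
    ensures T p (While e P1 # P, \<sigma>, L)"
  by (rule ensures_return) auto

lemma ensures_exec: "exec n g P \<sigma> t \<sigma>' \<Longrightarrow> t \<le> T \<Longrightarrow> ensures (T - t) p (Q, \<sigma>', L) \<Longrightarrow> ensures T p (P @ Q, \<sigma>, L)"
proof (induction arbitrary: T rule: exec.induct)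
  case (exec_Assign P \<sigma> x e t \<sigma>')
  then show ?case
    by (auto intro!: ensures_Assign simp: fun_upd_def)
next
  case (exec_Query e \<sigma> P x t \<sigma>')
  then show ?case
    by (auto intro!: ensures_Query simp: fun_upd_def)
next
  case (exec_If e \<sigma> P1 P2 P t \<sigma>')
  then show ?case
    by (auto intro!: ensures_If)
next
  case (exec_While_True e \<sigma> P1 P t \<sigma>')
  then show ?case
    by (auto intro!: ensures_While_True)
next
  case (exec_While_False e \<sigma> P t \<sigma>' P1)
  then show ?case
    by (auto intro!: ensures_While_False)
qed simp

end

section \<open>The learner\<close>

text \<open>In \<open>Task pre suf s s1 r p\<close> the subfunction \<open>g\<close> restricted by \<open>rev pre @ suf\<close> is to be learnt as
  a tree of size \<open>s\<close> and depth \<open>r\<close>, where the tester runs with parameter \<open>p\<close>. The zipper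
  \<open>(pre, suf)\<close> and \<open>s1\<close> give the next candidate for the root variable (the first one of \<open>suf\<close>) and
  for the size of the left subtree. \<open>Build i\<close> joins the top two finished trees by a node.\<close>

datatype item = Task point point nat nat nat real | Build nat

fun enc_item :: "item \<Rightarrow> val" where
  "enc_item (Task pre suf s s1 r p) =
    Cell (Num (real s)) (Cell (Num (real s1)) (Cell (Num (real r)) (Cell (Num p)
      (Cell (Num (real (length pre))) (Cell (enc_point pre) (enc_point suf))))))"
| "enc_item (Build i) = Num (real i)"

fun enc_list :: "val list \<Rightarrow> val" where
  "enc_list [] = Num 0"
| "enc_list (v # vs) = Cell v (enc_list vs)"

text \<open>Variables: 3 number of votes per test, 4 worklist, 5 stack of finished trees, 6 current item,
  7 and 8 restrictions of the two children, 9 and 10 results of the two tests, 12 balance of the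
  votes, 13 votes still to be cast, 14 query point; the others are temporary.\<close>

abbreviation "eS \<equiv> Head (Var 6)"
abbreviation "eS1 \<equiv> Head (Tail (Var 6))"
abbreviation "eR \<equiv> Head (Tail (Tail (Var 6)))"
abbreviation "eP \<equiv> Head (Tail (Tail (Tail (Var 6))))"
abbreviation "eI \<equiv> Head (Tail (Tail (Tail (Tail (Var 6)))))"
abbreviation "ePre \<equiv> Head (Tail (Tail (Tail (Tail (Tail (Var 6))))))"
abbreviation "eSuf \<equiv> Tail (Tail (Tail (Tail (Tail (Tail (Var 6))))))"

abbreviation mk_task :: "expr \<Rightarrow> expr \<Rightarrow> expr \<Rightarrow> expr \<Rightarrow> expr \<Rightarrow> expr \<Rightarrow> expr \<Rightarrow> expr" where
  "mk_task s s1 r p i pre suf \<equiv>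
    MkCell s (MkCell s1 (MkCell r (MkCell p (MkCell i (MkCell pre suf)))))"

abbreviation nonzero :: "expr \<Rightarrow> expr" where
  "nonzero e \<equiv> Plus (Less e (Lit 0)) (Less (Lit 0) e)"

text \<open>There is no multiplication; factors that are constants of the learner, such as
  \<open>K\<close> and \<open>2 ^ j\<close>, are unrolled into the program text.\<close>

fun mult_expr :: "nat \<Rightarrow> expr \<Rightarrow> expr" where
  "mult_expr 0 e = Lit 0"
| "mult_expr (Suc k) e = Plus e (mult_expr k e)"

fun halve_expr :: "nat \<Rightarrow> expr \<Rightarrow> expr" where
  "halve_expr 0 e = e"
| "halve_expr (Suc k) e = Half (halve_expr k e)"

definition rev_append :: "nat \<Rightarrow> nat \<Rightarrow> instr list" where
  "rev_append x y =
    [While (IsCell (Var y)) [Assign x (MkCell (Head (Var y)) (Var x)), Assign y (Tail (Var y))]]"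

definition fill_step :: "nat \<Rightarrow> instr list" where
  "fill_step x =
    [If (Head (Var x)) [Assign 15 (MkCell (Head (Var x)) (Var 15))]
       [Assign 15 (MkCell (Head (Var 14)) (Var 15))],
     Assign x (Tail (Var x)), Assign 14 (Tail (Var 14))]"

text \<open>The subroutine consumes the restriction in \<open>x\<close>, which does no harm: each
  query is answered from the store at the time of the call. The filled point arises in reverse order
  and is then turned round.\<close>

definition fill_query :: "nat \<Rightarrow> instr list" where
  "fill_query x =
    [Assign 15 (Lit 0), While (IsCell (Var x)) (fill_step x), Assign 14 (Lit 0)] @
    rev_append 14 15 @ [Query 14 (Var 14)]"

definition vote :: "nat \<Rightarrow> expr \<Rightarrow> nat \<Rightarrow> instr list" where
  "vote x e v =
    [CallA v e eP 14 (fill_query x),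
     Assign 12 (Minus (Plus (Var 12) (Plus (Var v) (Var v))) (Lit 1)),
     Assign 13 (Minus (Var 13) (Lit 1))]"

text \<open>The variable at the head of \<open>suf\<close> is set to \<open>b\<close> even when the
  restriction already fixes it; such candidates are discarded afterwards in
  \<open>decide_code\<close>.\<close>

definition test_child :: "nat \<Rightarrow> int \<Rightarrow> expr \<Rightarrow> nat \<Rightarrow> instr list" where
  "test_child x b e v =
    [Assign x (MkCell (Lit b) (Tail eSuf)), Assign 11 ePre] @ rev_append x 11 @
    [Assign 12 (Lit 0), Assign 13 (Var 3), While (Less (Lit 0) (Var 13)) (vote x e v),
     Assign v (Less (Lit 0) (Var 12))]"

text \<open>Truth values are 0 and 1, so the comparison with 1 expresses that both tests accepted
  and the variable is free. The children come in the order left, right, \<open>Build\<close>, hence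
  the right tree lies on top of the stack when they are joined.\<close>

definition decide_code :: "nat \<Rightarrow> instr list" where
  "decide_code j =
    [If (Less (Lit 1) (Minus (Plus (Var 9) (Var 10)) (nonzero (Head eSuf))))
      [Assign 4
        (MkCell (mk_task eS1 (Lit 1) (Minus eR (Lit 1)) (mult_expr (2 ^ j) eP) (Lit 0) (Lit 0) (Var 7))
          (MkCell (mk_task (Minus eS eS1) (Lit 1) (Minus eR (Lit 1)) (mult_expr (2 ^ j) eP)
              (Lit 0) (Lit 0) (Var 8))
            (MkCell eI (Var 4))))]
      [If (Less (Plus eS1 (Lit 1)) eS)
        [Assign 4 (MkCell (mk_task eS (Plus eS1 (Lit 1)) eR eP eI ePre eSuf) (Var 4))]
        [Assign 4 (MkCell (mk_task eS (Lit 1) eR eP (Plus eI (Lit 1))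
          (MkCell (Head eSuf) ePre) (Tail eSuf)) (Var 4))]]]"

definition search_code :: "nat \<Rightarrow> instr list" where
  "search_code j = test_child 7 (-1) eS1 9 @ test_child 8 1 (Minus eS eS1) 10 @ decide_code j"

text \<open>A coin is flipped for every variable, also for the fixed ones, so the coins always form
  a uniform point of the whole cube. Assigning 16 to itself gives both branches the same
  length.\<close>

definition sample_step :: "instr list" where
  "sample_step =
    [Flip 16, If (Head (Var 7)) [Assign 16 (Head (Var 7))] [Assign 16 (Var 16)],
     Assign 15 (MkCell (Var 16) (Var 15)), Assign 7 (Tail (Var 7))]"

definition leaf_code :: "instr list" where
  "leaf_code =
    [Assign 7 eSuf, Assign 11 ePre] @ rev_append 7 11 @
    [Assign 15 (Lit 0), While (IsCell (Var 7)) sample_step, Assign 14 (Lit 0)] @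
    rev_append 14 15 @ [Query 16 (Var 14), Assign 5 (MkCell (Var 16) (Var 5))]"

definition build_code :: "instr list" where
  "build_code =
    [Assign 5 (MkCell (MkCell (Var 6) (MkCell (Head (Tail (Var 5))) (Head (Var 5))))
      (Tail (Tail (Var 5))))]"

definition body_code :: "nat \<Rightarrow> instr list" where
  "body_code j =
    [Assign 6 (Head (Var 4)), Assign 4 (Tail (Var 4)),
     If (IsCell (Var 6))
       [If (Less (Lit 2) (Plus (IsCell eSuf) (Plus (Less (Lit 0) eR) (Less eS1 eS))))
         (search_code j) leaf_code]
       build_code]"

text \<open>The tester parameter starts at \<open>2 powr (- q - Suc j * D)\<close> for the maximal depth \<open>D\<close> and grows by
  the factor \<open>2 ^ j\<close> on each level, so that it never exceeds \<open>2 powr (- q - D)\<close>.\<close>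

definition init_code :: "nat \<Rightarrow> nat \<Rightarrow> nat \<Rightarrow> instr list" where
  "init_code j q K =
    [Assign 3 (mult_expr K (Plus (Plus (Var 0) (Var 1)) (Lit 1))),
     Assign 9 (Var 1), Assign 13 (halve_expr q (Lit 1)),
     While (Less (Var 2) (Plus (Var 9) (Var 9)))
      [Assign 9 (Half (Var 9)), Assign 10 (Plus (Var 10) (Lit 1)),
       Assign 13 (halve_expr (Suc j) (Var 13))],
     Assign 12 (Var 0),
     While (Less (Lit 0) (Var 12))
      [Assign 11 (MkCell (Lit 0) (Var 11)), Assign 12 (Minus (Var 12) (Lit 1))],
     Assign 4 (MkCell (mk_task (Var 1) (Lit 1) (Var 10) (Var 13) (Lit 0) (Lit 0) (Var 11)) (Lit 0))]"

definition learner_code :: "nat \<Rightarrow> nat \<Rightarrow> nat \<Rightarrow> instr list" where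
  "learner_code j q K =
    init_code j q K @ [While (IsCell (Var 4)) (body_code j), Assign 0 (Head (Var 5))]"

section \<open>Executions of the subroutines\<close>

lemma num_mult_expr: "num (expr_val (mult_expr k e) \<sigma>) = real k * num (expr_val e \<sigma>)"
  by (induction k) (auto simp: algebra_simps)

lemma expr_val_mult_expr: "expr_val (mult_expr k e) \<sigma> = Num (real k * num (expr_val e \<sigma>))"
  by (cases k) (auto simp: num_mult_expr algebra_simps)

lemma expr_val_halve_expr: 
  "expr_val e \<sigma> = Num x \<Longrightarrow> expr_val (halve_expr k e) \<sigma> = Num (x / 2 ^ k)"
  by (induction k) auto

lemma dec_enc_point [simp]: "dec_point (enc_point x) = x"
  by (induction x) auto

lemma is_cell_enc_point: "is_cell (enc_point x) \<longleftrightarrow> x \<noteq> []"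
  by (cases x) auto

lemma exec_rev_append:
  assumes "x \<noteq> y" "\<sigma> x = enc_point xs" "\<sigma> y = enc_point ys"
  shows "exec n g (rev_append x y) \<sigma> (3 * length ys + 1) (\<sigma>(x := enc_point (rev ys @ xs), y := Num 0))"
  using assms
proof (induction ys arbitrary: xs \<sigma>)
  case Nil
  then have eq: "\<sigma>(x := enc_point (rev [] @ xs), y := Num 0) = \<sigma>"
    by auto
  show ?case
    using Nil exec_While_False[OF _ exec_Nil, where \<sigma> = \<sigma>]
    by (subst eq) (simp add: rev_append_def holds_def)
next
  case (Cons a ys)
  let ?\<sigma> = "\<sigma>(x := Cell (Num a) (\<sigma> x), y := enc_point ys)"
  have "exec n g (rev_append x y) ?\<sigma> (3 * length ys + 1)
      (?\<sigma>(x := enc_point (rev ys @ a # xs), y := Num 0))"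
    using Cons.prems by (intro Cons.IH) auto
  moreover have "?\<sigma>(x := enc_point (rev ys @ a # xs), y := Num 0) =
      \<sigma>(x := enc_point (rev (a # ys) @ xs), y := Num 0)"
    by auto
  ultimately have "exec n g (rev_append x y) ?\<sigma> (3 * length ys + 1)
      (\<sigma>(x := enc_point (rev (a # ys) @ xs), y := Num 0))"
    by simp
  then have *: "exec n g (rev_append x y) (\<sigma>(x := Cell (Num a) (\<sigma> x), y := tail (\<sigma> y)))
      (3 * length ys + 1) (\<sigma>(x := enc_point (rev (a # ys) @ xs), y := Num 0))"
    using Cons.prems by simp
  have time: "3 * length (a # ys) + 1 = Suc (Suc (Suc (3 * length ys + 1)))"
    by simp
  show ?case
    unfolding time rev_append_def
  proof (rule exec_While_True)
    show "holds (IsCell (Var y)) \<sigma>"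
      using Cons.prems by (simp add: holds_def)
    show "exec n g ([Assign x (MkCell (Head (Var y)) (Var x)), Assign y (Tail (Var y))] @
        [While (IsCell (Var y)) [Assign x (MkCell (Head (Var y)) (Var x)), Assign y (Tail (Var y))]])
        \<sigma> (Suc (Suc (3 * length ys + 1))) (\<sigma>(x := enc_point (rev (a # ys) @ xs), y := Num 0))"
      using * Cons.prems unfolding append_Cons append_Nil rev_append_def
      by (intro exec_Assign) simp
  qed
qed

lemma exec_fill_loop:
  assumes "x \<notin> {14, 15}" "\<sigma> x = enc_point \<rho>" "\<sigma> 14 = enc_point q" "\<sigma> 15 = enc_point a"
    and "length \<rho> = length q"
  shows "exec n g [While (IsCell (Var x)) (fill_step x)] \<sigma> (5 * length \<rho> + 1)
    (\<sigma>(x := Num 0, 14 := Num 0, 15 := enc_point (rev (fill \<rho> q) @ a)))"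
  using assms
proof (induction \<rho> arbitrary: q a \<sigma>)
  case Nil
  then have eq: "\<sigma>(x := Num 0, 14 := Num 0, 15 := enc_point (rev (fill [] q) @ a)) = \<sigma>"
    by (auto simp: fun_eq_iff)
  show ?case
    using Nil exec_While_False[OF _ exec_Nil, where \<sigma> = \<sigma>] by (subst eq) (simp add: holds_def)
next
  case (Cons b \<rho>)
  then obtain c q' where q: "q = c # q'"
    by (cases q) auto
  define d where "d = (if b \<noteq> 0 then b else c)"
  let ?\<sigma> = "\<sigma>(15 := enc_point (d # a), x := enc_point \<rho>, 14 := enc_point q')"
  let ?\<sigma>' = "\<sigma>(x := Num 0, 14 := Num 0, 15 := enc_point (rev (fill (b # \<rho>) q) @ a))"
  have "exec n g [While (IsCell (Var x)) (fill_step x)] ?\<sigma> (5 * length \<rho> + 1)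
      (?\<sigma>(x := Num 0, 14 := Num 0, 15 := enc_point (rev (fill \<rho> q') @ d # a)))"
    using Cons.prems q by (intro Cons.IH) auto
  moreover have "?\<sigma>(x := Num 0, 14 := Num 0, 15 := enc_point (rev (fill \<rho> q') @ d # a)) = ?\<sigma>'"
    using Cons.prems(1) by (auto simp: q d_def fun_eq_iff)
  ultimately have *: "exec n g [While (IsCell (Var x)) (fill_step x)] ?\<sigma> (5 * length \<rho> + 1) ?\<sigma>'"
    by simp
  have "exec n g (fill_step x) \<sigma> 4 ?\<sigma>"
    unfolding fill_step_def numeral_eq_Suc pred_numeral_simps
    apply (rule exec_If)
    apply (cases "b = 0")
    using Cons.prems by (auto simp: holds_def q d_def eval_nat_numeral intro!: exec.intros)
  note ** = exec_append[OF this *]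
  have time: "5 * length (b # \<rho>) + 1 = Suc (4 + (5 * length \<rho> + 1))"
    by simp
  show ?case
    unfolding time by (rule exec_While_True[OF _ **]) (use Cons.prems(2) in \<open>simp add: holds_def\<close>)
qed

lemma exec_fill_query:
  assumes x: "x \<notin> {14, 15}" "\<sigma> x = enc_point \<rho>" "\<sigma> 14 = enc_point q"
    and \<rho>: "\<rho> \<in> restrictions n" "q \<in> cube n"
  shows "exec n g (fill_query x) \<sigma> (8 * n + 5) (\<sigma>(x := Num 0, 15 := Num 0, 14 := Num (g (fill \<rho> q))))"
proof -
  let ?y = "fill \<rho> q"
  let ?\<sigma>1 = "\<sigma>(15 := Num 0, x := Num 0, 14 := Num 0, 15 := enc_point (rev ?y))"
  have len: "length \<rho> = n" "length q = n" "length ?y = n"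
    using \<rho> by (auto simp: restrictions_def length_cube length_fill)
  have 0: "exec n g [Assign 15 (Lit 0)] \<sigma> 1 (\<sigma>(15 := Num 0))"
    using exec_Assign[OF exec_Nil, where e = "Lit 0"] by simp
  have 1: "exec n g [While (IsCell (Var x)) (fill_step x)] (\<sigma>(15 := Num 0)) (5 * n + 1) ?\<sigma>1"
    using exec_fill_loop[where \<sigma> = "\<sigma>(15 := Num 0)" and a = "[]"] x len by force
  have 2: "exec n g [Assign 14 (Lit 0)] ?\<sigma>1 1 ?\<sigma>1"
    using exec_Assign[OF exec_Nil, where e = "Lit 0" and x = 14 and \<sigma> = ?\<sigma>1]
    by (simp add: fun_upd_twist)
  have 3: "exec n g (rev_append 14 15) ?\<sigma>1 (3 * n + 1) (?\<sigma>1(14 := enc_point ?y, 15 := Num 0))"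
    using exec_rev_append[where x = 14 and y = 15 and \<sigma> = ?\<sigma>1 and xs = "[]" and ys = "rev ?y"] len by simp
  have 4: "exec n g [Query 14 (Var 14)] (?\<sigma>1(14 := enc_point ?y, 15 := Num 0)) 1
      (?\<sigma>1(14 := Num (g ?y), 15 := Num 0))"
    using exec_Query[OF _ exec_Nil, where e = "Var 14" and x = 14 and g = g and n = n
        and \<sigma> = "?\<sigma>1(14 := enc_point ?y, 15 := Num 0)"] fill_cube[OF \<rho>]
    by (simp add: fun_upd_twist)
  have "?\<sigma>1(14 := Num (g ?y), 15 := Num 0) = \<sigma>(x := Num 0, 15 := Num 0, 14 := Num (g ?y))"
    using x(1) by (auto simp: fun_eq_iff)
  moreover have "1 + (5 * n + 1 + (1 + (3 * n + 1 + 1))) = 8 * n + 5"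
    by simp
  ultimately show ?thesis
    using exec_append[OF 0 exec_append[OF 1 exec_append[OF 2 exec_append[OF 3 4]]]]
    unfolding fill_query_def by (simp only: append_Cons append_Nil)
qed

text \<open>Each flip averages over one coordinate, so the coins together give the mean of
  \<open>h\<close> over the cube. The bound is indexed by the coins \<open>q\<close> and not by the
  filled point, whose distribution is not uniform in general.\<close>

lemma (in execution) ensures_sample:
  assumes "\<sigma> 7 = enc_point \<rho>" "\<sigma> 15 = enc_point a"
    and "\<And>q \<sigma>'. q \<in> cube (length \<rho>) \<Longrightarrow> (\<And>z. z \<notin> {7, 15, 16} \<Longrightarrow> \<sigma>' z = \<sigma> z) \<Longrightarrow>
      \<sigma>' 15 = enc_point (rev (fill \<rho> q) @ a) \<Longrightarrow> ensures T (h q) (Q, \<sigma>', L)"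
  shows "ensures (T + 6 * length \<rho> + 1) ((\<Sum>q\<in>cube (length \<rho>). h q) / 2 ^ length \<rho>)
    (While (IsCell (Var 7)) sample_step # Q, \<sigma>, L)"
  using assms
proof (induction \<rho> arbitrary: \<sigma> a h)
  case Nil
  show ?case
    using Nil(1) Nil(2) by (auto intro!: ensures_While_False Nil(3) simp: holds_def)
next
  case (Cons b \<rho>)
  let ?l = "length \<rho>"
  define h' where "h' d = (\<Sum>q\<in>cube ?l. h (d # q)) / 2 ^ ?l" for d
  have loop: "ensures (Suc (T + 6 * ?l)) (h' d) (While (IsCell (Var 7)) sample_step # Q, \<sigma>', L)"
    if "\<sigma>' 7 = enc_point \<rho>" "\<sigma>' 15 = enc_point ((if b \<noteq> 0 then b else d) # a)"
      "\<And>z. z \<notin> {7, 15, 16} \<Longrightarrow> \<sigma>' z = \<sigma> z" "d \<in> {-1, 1}" for d \<sigma>'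
    unfolding h'_def Suc_eq_plus1 using that(1,2)
  proof (rule Cons.IH)
    fix q \<tau> assume *: "q \<in> cube ?l" "\<And>z. z \<notin> {7, 15, 16} \<Longrightarrow> \<tau> z = \<sigma>' z"
      "\<tau> 15 = enc_point (rev (fill \<rho> q) @ (if b \<noteq> 0 then b else d) # a)"
    then show "ensures T (h (d # q)) (Q, \<tau>, L)"
      using that(3,4) by (intro Cons.prems(3)) (auto simp: cube_def)
  qed
  have "ensures (Suc (T + 6 * ?l + 5)) ((h' (-1) + h' 1) / 2)
      (sample_step @ While (IsCell (Var 7)) sample_step # Q, \<sigma>, L)"
    unfolding sample_step_def append_Cons append_Nil
  proof (rule ensures_Flip)
    fix d :: real assume d: "d \<in> {-1, 1}"
    show "ensures (T + 6 * ?l + 5) (h' d)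
      (If (Head (Var 7)) [Assign 16 (Head (Var 7))] [Assign 16 (Var 16)] #
       Assign 15 (MkCell (Var 16) (Var 15)) # Assign 7 (Tail (Var 7)) # 
       While (IsCell (Var 7)) [Flip 16, If (Head (Var 7)) [Assign 16 (Head (Var 7))] [Assign 16 (Var 16)],
        Assign 15 (MkCell (Var 16) (Var 15)), Assign 7 (Tail (Var 7))] # Q, \<sigma>(16 := Num d), L)"
      apply (rule ensures_If, simp)
      apply (rule ensures_mono[where T = "T + 6 * ?l + 5 - 1" and p = "h' d"])
      subgoal
        using Cons.prems(1,2) d
        by (cases "b = 0")
          (auto simp: holds_def sample_step_def[symmetric] intro!: ensures_Assign loop split: if_splits)
      by auto
  qed
  then have "ensures (T + 6 * length (b # \<rho>) + 1) ((h' (-1) + h' 1) / 2)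
      (While (IsCell (Var 7)) sample_step # Q, \<sigma>, L)"
    using Cons.prems(1) by (intro ensures_While_True) (auto simp: holds_def elim!: ensures_mono)
  moreover have "(h' (-1) + h' 1) / 2 = (\<Sum>q\<in>cube (length (b # \<rho>)). h q) / 2 ^ length (b # \<rho>)"
    by (simp add: h'_def sum_cube_Suc add_divide_distrib)
  ultimately show ?case
    by simp
qed

section \<open>Analysis of one iteration\<close>

text \<open>\<open>S\<close> bounds the sizes of trees, \<open>R\<close> is the number of votes per
  test, \<open>V\<close> and \<open>m\<close> bound the output and the number of calls, and the
  tester parameters lie between \<open>p_min\<close> and \<open>P\<close>. The pair \<omega>,
  \<theta> controls the exponential moment of the votes.\<close>

locale learner =
  fixes A :: tester and n :: nat and g :: "point \<Rightarrow> real"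
    and S R j V m :: nat and \<epsilon> C \<delta> \<omega> \<theta> p_min P :: real
  assumes g: "bool_fun n g"
    and tester: "\<And>s \<epsilon> f. 0 < \<epsilon> \<Longrightarrow> \<epsilon> < 1 \<Longrightarrow> bool_fun n f \<Longrightarrow> tree_close n s \<epsilon> f \<Longrightarrow>
      pmf (A n s \<epsilon> f) True \<ge> 1 - \<delta>"
      "\<And>s \<epsilon> f. 0 < \<epsilon> \<Longrightarrow> \<epsilon> < 1 \<Longrightarrow> bool_fun n f \<Longrightarrow> \<not> tree_close n s (C * \<epsilon>) f \<Longrightarrow>
      pmf (A n s \<epsilon> f) False \<ge> 1 - \<delta>"
    and C: "1 \<le> C" "2 * C \<le> 2 ^ j"
    and \<omega>: "0 < \<omega>" "\<omega> < 1" "0 < \<theta>" "(1 - \<delta>) * \<omega> + \<delta> / \<omega> \<le> \<theta>"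
    and p_min: "0 < p_min" and P: "0 < P" "P < 1"
begin

definition ok_call :: "call \<Rightarrow> bool" where
  "ok_call a \<longleftrightarrow> call_s a \<le> S \<and> p_min \<le> call_eps a \<and> call_eps a < 1 \<and>
    bool_fun n (sub_fun n g (call_var a) (call_sub a) (call_store a)) \<and>
    (\<forall>q\<in>cube n. \<forall>t\<ge>8 * n + 5.
      fst (sub_run n g (call_var a) (call_sub a) (call_store a) q t) = [])"

definition safe :: "config set" where
  "safe = {(Q, \<sigma>, L). Q = [] \<and> vsize (\<sigma> 0) \<le> V \<and> length L \<le> m \<and> (\<forall>a\<in>set L. ok_call a)}"

definition bad :: "config set" where
  "bad = {C. \<not> outputs_close_tree n \<epsilon> g C}"

sublocale execution A n g safe bad .

section \<open>Amplification of the tester by votes\<close>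

abbreviation restr :: "point \<Rightarrow> point \<Rightarrow> real" where
  "restr \<rho> \<equiv> \<lambda>x. g (fill \<rho> x)"

lemma bool_fun_restr: "\<rho> \<in> restrictions n \<Longrightarrow> bool_fun n (restr \<rho>)"
  using g fill_cube unfolding bool_fun_def by blast

text \<open>\<open>h r z\<close> bounds the error with \<open>r\<close> votes to come and balance
  \<open>z\<close>; the hypothesis on \<open>h\<close> makes it a supermartingale. It ranges over
  every \<open>f\<close> that agrees with the restriction on the cube, since the function given to
  the tester depends on the current store and is controlled only on the cube.\<close>

lemma ensures_votes:
  assumes frame: "x \<notin> {v, 12, 13, 14, 15}" "v \<notin> {6, 12, 13}"
    and \<tau>: "\<tau> x = enc_point \<rho>" "\<rho> \<in> restrictions n"
    and e: "\<And>\<sigma>. \<sigma> 6 = \<tau> 6 \<Longrightarrow> expr_val e \<sigma> = Num (real u)" "u \<le> S"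
    and p: "expr_val eP \<tau> = Num p" "p_min \<le> p" "p < 1"
    and h: "\<And>r z f. (\<And>q. q \<in> cube n \<Longrightarrow> f q = restr \<rho> q) \<Longrightarrow>
      pmf (A n u p f) True * h r (z + 1) + pmf (A n u p f) False * h r (z - 1) \<le> h (Suc r) z"
    and cont: "\<And>\<sigma> L z. (\<And>y. y \<notin> {v, 12, 13} \<Longrightarrow> \<sigma> y = \<tau> y) \<Longrightarrow> \<sigma> 12 = Num z \<Longrightarrow>
      length L = l \<Longrightarrow> (\<And>a. a \<in> set L \<Longrightarrow> ok_call a) \<Longrightarrow> ensures T (h 0 z) (Q, \<sigma>, L)"
  shows "(\<And>y. y \<notin> {v, 12, 13} \<Longrightarrow> \<sigma> y = \<tau> y) \<Longrightarrow> \<sigma> 12 = Num z \<Longrightarrow> \<sigma> 13 = Num (real r) \<Longrightarrow>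
    length L + r = l \<Longrightarrow> (\<And>a. a \<in> set L \<Longrightarrow> ok_call a) \<Longrightarrow>
    ensures (T + 4 * r + 1) (h r z) (While (Less (Lit 0) (Var 13)) (vote x e v) # Q, \<sigma>, L)"
proof (induction r arbitrary: \<sigma> z L)
  case 0
  have "ensures T (h 0 z) (Q, \<sigma>, L)"
    by (rule cont) (use 0 in simp_all)
  then show ?case
    using 0 by (intro ensures_While_False) (auto simp: holds_def)
next
  case (Suc r)
  define f where "f = sub_fun n g 14 (fill_query x) \<sigma>"
  define c where "c = \<lparr>call_s = u, call_eps = p, call_var = 14, call_sub = fill_query x, call_store = \<sigma>\<rparr>"
  have x: "\<sigma> x = enc_point \<rho>" "x \<notin> {14, 15}" and 6: "\<sigma> 6 = \<tau> 6"
    using Suc.prems(1) frame \<tau> by auto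
  have exec: "exec n g (fill_query x) (\<sigma>(14 := enc_point q)) (8 * n + 5)
      ((\<sigma>(14 := enc_point q))(x := Num 0, 15 := Num 0, 14 := Num (restr \<rho> q)))" if "q \<in> cube n" for q
    using x \<tau>(2) that by (intro exec_fill_query) auto
  have f: "f q = restr \<rho> q" if "q \<in> cube n" for q
    using sub_fun_exec[OF exec[OF that]] by (simp add: f_def)
  have "bool_fun n f"
    using bool_fun_restr[OF \<tau>(2)] f by (auto simp: bool_fun_def)
  then have c: "ok_call c"
    using e(2) p sub_run_exec[OF exec] by (auto simp: c_def ok_call_def f_def)
  have vote: "vote x e v @ P = CallA v e eP 14 (fill_query x) #
      Assign 12 (Minus (Plus (Var 12) (Plus (Var v) (Var v))) (Lit 1)) #
      Assign 13 (Minus (Var 13) (Lit 1)) # P" for P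
    by (simp add: vote_def)
  have "ensures (Suc (T + 4 * r + 3)) (h (Suc r) z)
      (vote x e v @ While (Less (Lit 0) (Var 13)) (vote x e v) # Q, \<sigma>, L)"
    unfolding vote
  proof (rule ensures_CallA[where s = u and \<epsilon> = p and q = "\<lambda>b. h r (z + (if b then 1 else -1))"])
    show "u = nat \<lfloor>num (expr_val e \<sigma>)\<rfloor>"
      using 6 by (simp add: e(1))
    show "p = num (expr_val eP \<sigma>)"
      using p(1) 6 by simp
    show "pmf (A n u p (sub_fun n g 14 (fill_query x) \<sigma>)) True * h r (z + (if True then 1 else -1)) +
        pmf (A n u p (sub_fun n g 14 (fill_query x) \<sigma>)) False * h r (z + (if False then 1 else -1))
        \<le> h (Suc r) z"
      using h[OF f, where r = r and z = z] by (simp add: f_def)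
  next
    fix b
    define \<sigma>' where "\<sigma>' = \<sigma>(v := Num (of_bool b), 12 := Num (z + (if b then 1 else -1)), 13 := Num (real r))"
    have "ensures (T + 4 * r + 1) (h r (z + (if b then 1 else -1)))
        (While (Less (Lit 0) (Var 13)) (vote x e v) # Q, \<sigma>', c # L)"
      by (rule Suc.IH) (use Suc.prems frame c in \<open>auto simp: \<sigma>'_def\<close>)
    moreover have "(\<sigma>(v := Num (of_bool b)))
        (12 := expr_val (Minus (Plus (Var 12) (Plus (Var v) (Var v))) (Lit 1)) (\<sigma>(v := Num (of_bool b))),
         13 := Num (real r)) = \<sigma>'"
      using Suc.prems(2) frame by (auto simp: \<sigma>'_def)
    ultimately show "ensures (T + 4 * r + 3) (h r (z + (if b then 1 else -1)))
        (Assign 12 (Minus (Plus (Var 12) (Plus (Var v) (Var v))) (Lit 1)) #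
         Assign 13 (Minus (Var 13) (Lit 1)) # While (Less (Lit 0) (Var 13)) (vote x e v) # Q,
         \<sigma>(v := Num (of_bool b)),
         \<lparr>call_s = u, call_eps = p, call_var = 14, call_sub = fill_query x, call_store = \<sigma>\<rparr> # L)"
      using Suc.prems(3) frame unfolding c_def
      by (intro ensures_Assign) (simp_all add: numeral_3_eq_3)
  qed
  then show ?case
    using Suc.prems(3) by (intro ensures_While_True) (auto simp: holds_def elim!: ensures_mono)
qed

text \<open>Each vote multiplies the expectation of \<open>\<omega>\<close> to the power (correct minus wrong votes) by at most \<open>\<theta>\<close>.\<close>

lemma vote_drift:
  assumes "1 - \<delta> \<le> a" "a \<le> 1"
  shows "a * \<omega> + (1 - a) / \<omega> \<le> \<theta>"
proof -
  have "\<omega> * \<omega> \<le> 1"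
    using \<omega> by (intro mult_le_one) auto
  then have "\<omega> \<le> 1 / \<omega>"
    using \<omega> by (simp add: pos_le_divide_eq)
  \<comment> \<open>The moment decreases in \<open>a\<close>, so the least guaranteed success
    probability is the worst case.\<close>
  then have "0 \<le> (a - (1 - \<delta>)) * (1 / \<omega> - \<omega>)"
    using assms by simp
  then have "a * \<omega> + (1 - a) / \<omega> \<le> (1 - \<delta>) * \<omega> + \<delta> / \<omega>"
    by (simp add: algebra_simps diff_divide_distrib add_divide_distrib)
  then show ?thesis
    using \<omega>(4) by linarith
qed

text \<open>In the gap between \<open>p\<close> and \<open>C * p\<close> both verdicts count as
  right: this is all that the tester promises and all that the search uses.\<close>

definition rightly :: "nat \<Rightarrow> real \<Rightarrow> point \<Rightarrow> bool \<Rightarrow> bool" where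
  "rightly u p \<rho> d \<longleftrightarrow>
    (if d then tree_close n u (C * p) (restr \<rho>) else \<not> tree_close n u p (restr \<rho>))"

definition potential :: "nat \<Rightarrow> real \<Rightarrow> point \<Rightarrow> real \<Rightarrow> (nat \<Rightarrow> real \<Rightarrow> real) \<Rightarrow> bool" where
  "potential u p \<rho> a h \<longleftrightarrow>
    (\<forall>r z f. (\<forall>q\<in>cube n. f q = restr \<rho> q) \<longrightarrow>
      pmf (A n u p f) True * h r (z + 1) + pmf (A n u p f) False * h r (z - 1) \<le> h (Suc r) z) \<and>
    (\<forall>z. (if rightly u p \<rho> (0 < z) then a else 1) \<le> h 0 z) \<and>
    h R 0 \<le> a + \<theta> ^ R"

text \<open>An exponential moment argument as for Chernoff bounds. Where the tester has to accept,
  \<open>\<theta> ^ r * \<omega> powr z\<close> is added to \<open>a\<close>; as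
  \<open>\<omega> < 1\<close>, its power of \<omega> is at least 1 if the balance ends at 0 or
  below. Where it has to reject, the sign of \<open>z\<close> is reversed, and in the gap the
  constant \<open>a\<close> suffices.\<close>

lemma ex_potential:
  assumes \<rho>: "\<rho> \<in> restrictions n" and p: "0 < p" "p < 1" and a: "0 \<le> a"
  shows "\<exists>h. potential u p \<rho> a h"
proof -
  have sum: "pmf M False = 1 - pmf M True" for M
  proof -
    have "(\<Sum>b\<in>UNIV. pmf M b) = 1"
      by (rule sum_pmf_eq_1) auto
    then show ?thesis
      by (simp add: UNIV_bool)
  qed
  have le1: "pmf M b \<le> 1" for M and b :: bool
    by (rule pmf_le_1)
  have bf: "bool_fun n f" and cl: "tree_close n u e f \<longleftrightarrow> tree_close n u e (restr \<rho>)"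
    if "\<forall>q\<in>cube n. f q = restr \<rho> q" for f e
    using that bool_fun_restr[OF \<rho>] by (auto simp: bool_fun_def intro!: tree_close_cong)
  have mono: "tree_close n u p (restr \<rho>) \<Longrightarrow> tree_close n u (C * p) (restr \<rho>)"
    by (erule tree_close_mono) (use C p in simp)
  have powr: "\<omega> powr (z + 1) = \<omega> powr z * \<omega>" "\<omega> powr (z - 1) = \<omega> powr z / \<omega>"
    "\<omega> powr (- (z - 1)) = \<omega> powr (- z) * \<omega>" "\<omega> powr (- (z + 1)) = \<omega> powr (- z) / \<omega>" for z
    using \<omega> by (simp_all add: powr_add powr_diff powr_minus field_simps)
  have powr_ge: "1 \<le> \<omega> powr z" if "z \<le> 0" for z
    using \<omega> that powr_mono'[of z 0 \<omega>] by simp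
  consider "tree_close n u p (restr \<rho>)" | "\<not> tree_close n u (C * p) (restr \<rho>)"
    | "tree_close n u (C * p) (restr \<rho>)" "\<not> tree_close n u p (restr \<rho>)"
    by blast
  then show ?thesis
  proof cases
    case 1
    define h where "h r z = a + \<theta> ^ r * \<omega> powr z" for r :: nat and z
    have "pmf (A n u p f) True * h r (z + 1) + pmf (A n u p f) False * h r (z - 1) \<le> h (Suc r) z"
      if "\<forall>q\<in>cube n. f q = restr \<rho> q" for r z f
    proof -
      let ?b = "pmf (A n u p f) True"
      have "1 - \<delta> \<le> ?b"
        using tester(1)[OF p bf[OF that]] 1 cl[OF that] by blast
      then have "\<theta> ^ r * \<omega> powr z * (?b * \<omega> + (1 - ?b) / \<omega>) \<le> \<theta> ^ r * \<omega> powr z * \<theta>"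
        using \<omega> le1 by (intro mult_left_mono vote_drift) auto
      then show ?thesis
        unfolding h_def sum powr by (simp add: algebra_simps)
    qed
    moreover have "(if rightly u p \<rho> (0 < z) then a else 1) \<le> h 0 z" for z
      using powr_ge[of z] a \<omega> 1 mono by (auto simp: rightly_def h_def)
    moreover have "h R 0 \<le> a + \<theta> ^ R"
      using \<omega> by (simp add: h_def)
    ultimately have "potential u p \<rho> a h"
      by (simp add: potential_def)
    then show ?thesis
      by (rule exI[of _ h])
  next
    case 2
    define h where "h r z = a + \<theta> ^ r * \<omega> powr (- z)" for r :: nat and z
    have "pmf (A n u p f) True * h r (z + 1) + pmf (A n u p f) False * h r (z - 1) \<le> h (Suc r) z"
      if "\<forall>q\<in>cube n. f q = restr \<rho> q" for r z f
    proof -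
      let ?b = "pmf (A n u p f) False"
      have "1 - \<delta> \<le> ?b"
        using tester(2)[OF p bf[OF that]] 2 cl[OF that] by blast
      then have *: "\<theta> ^ r * \<omega> powr (- z) * (?b * \<omega> + (1 - ?b) / \<omega>) \<le> \<theta> ^ r * \<omega> powr (- z) * \<theta>"
        using \<omega> le1 by (intro mult_left_mono vote_drift) auto
      have True: "pmf (A n u p f) True = 1 - ?b"
        using sum by simp
      show ?thesis
        using * unfolding h_def powr True by (simp add: algebra_simps)
    qed
    moreover have "(if rightly u p \<rho> (0 < z) then a else 1) \<le> h 0 z" for z
      using powr_ge[of "- z"] a \<omega> 2 mono by (auto simp: rightly_def h_def)
    moreover have "h R 0 \<le> a + \<theta> ^ R"
      using \<omega> by (simp add: h_def)
    ultimately have "potential u p \<rho> a h"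
      by (simp add: potential_def)
    then show ?thesis
      by (rule exI[of _ h])
  next
    case 3
    then have "rightly u p \<rho> d" for d
      by (simp add: rightly_def)
    then show ?thesis
      using \<omega> a by (intro exI[of _ "\<lambda>r z. a"]) (simp add: potential_def sum algebra_simps)
  qed
qed

lemma ensures_test_child:
  assumes frame: "x \<notin> {3, 6, 11, 12, 13, 14, 15}" "v \<notin> {3, 6, 11, 12, 13}" "x \<noteq> v"
    and \<sigma>: "\<sigma> 6 = enc_item (Task pre (b0 # suf) s s1 r p)" "\<sigma> 3 = Num (real R)"
    and \<rho>: "\<rho> = rev pre @ real_of_int b # suf" "\<rho> \<in> restrictions n"
    and e: "\<And>\<tau>. \<tau> 6 = \<sigma> 6 \<Longrightarrow> expr_val e \<tau> = Num (real u)" "u \<le> S"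
    and p: "p_min \<le> p" "p < 1" and a: "0 \<le> a"
    and L: "\<And>c. c \<in> set L \<Longrightarrow> ok_call c"
    and cont: "\<And>\<tau> L' d. (\<And>y. y \<notin> {x, v, 11, 12, 13} \<Longrightarrow> \<tau> y = \<sigma> y) \<Longrightarrow> \<tau> x = enc_point \<rho> \<Longrightarrow>
      \<tau> v = Num (of_bool d) \<Longrightarrow> length L' = length L + R \<Longrightarrow> (\<And>c. c \<in> set L' \<Longrightarrow> ok_call c) \<Longrightarrow>
      ensures T (if rightly u p \<rho> d then a else 1) (Q, \<tau>, L')"
  shows "ensures (T + 4 * R + 3 * n + 7) (a + \<theta> ^ R) (test_child x b e v @ Q, \<sigma>, L)"
proof -
  have "0 < p"
    using p p_min by linarith
  then obtain h where pot: "potential u p \<rho> a h"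
    using ex_potential[OF \<rho>(2) _ p(2) a] by blast
  then have h: "\<forall>r z f. (\<forall>q\<in>cube n. f q = restr \<rho> q) \<longrightarrow>
      pmf (A n u p f) True * h r (z + 1) + pmf (A n u p f) False * h r (z - 1) \<le> h (Suc r) z"
    "\<forall>z. (if rightly u p \<rho> (0 < z) then a else 1) \<le> h 0 z" "h R 0 \<le> a + \<theta> ^ R"
    unfolding potential_def by blast+
  define \<sigma>1 where "\<sigma>1 = \<sigma>(x := enc_point (real_of_int b # suf), 11 := enc_point pre)"
  define \<sigma>2 where "\<sigma>2 = \<sigma>1(x := enc_point \<rho>, 11 := Num 0)"
  define \<sigma>3 where "\<sigma>3 = \<sigma>2(12 := Num 0, 13 := Num (real R))"
  have len: "length pre \<le> n"
    using \<rho> by (auto simp: restrictions_def)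
  have "ensures (T + 1 + 4 * R + 1) (h R 0)
      (While (Less (Lit 0) (Var 13)) (vote x e v) # Assign v (Less (Lit 0) (Var 12)) # Q, \<sigma>3, L)"
  proof (rule ensures_votes[where \<tau> = \<sigma>3 and h = h and r = R and z = 0 and l = "length L + R"])
    show "x \<notin> {v, 12, 13, 14, 15}" "v \<notin> {6, 12, 13}"
      using frame by auto
    show "\<sigma>3 x = enc_point \<rho>"
      using frame by (simp add: \<sigma>3_def \<sigma>2_def)
    have "\<sigma>3 6 = \<sigma> 6"
      using frame by (simp add: \<sigma>3_def \<sigma>2_def \<sigma>1_def)
    then show "expr_val eP \<sigma>3 = Num p" "\<And>\<tau>. \<tau> 6 = \<sigma>3 6 \<Longrightarrow> expr_val e \<tau> = Num (real u)"
      using e(1) \<sigma>(1) by auto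
  next
    fix \<tau> L' z
    assume *: "\<And>y. y \<notin> {v, 12, 13} \<Longrightarrow> \<tau> y = \<sigma>3 y" "\<tau> 12 = Num z" "length L' = length L + R"
      "\<And>a. a \<in> set L' \<Longrightarrow> ok_call a"
    have "ensures T (if rightly u p \<rho> (0 < z) then a else 1) (Q, \<tau>(v := Num (of_bool (0 < z))), L')"
      by (rule cont) (use * frame in \<open>auto simp: \<sigma>3_def \<sigma>2_def \<sigma>1_def\<close>)
    then have "ensures T (h 0 z) (Q, \<tau>(v := Num (of_bool (0 < z))), L')"
      by (rule ensures_mono[OF _ order_refl h(2)[rule_format]])
    then show "ensures (T + 1) (h 0 z) (Assign v (Less (Lit 0) (Var 12)) # Q, \<tau>, L')"
      using *(2) by (intro ensures_Assign) auto
  next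
    fix r z f assume "\<And>q. q \<in> cube n \<Longrightarrow> f q = restr \<rho> q"
    then show "pmf (A n u p f) True * h r (z + 1) + pmf (A n u p f) False * h r (z - 1) \<le> h (Suc r) z"
      using h(1) by blast
  qed (use e(2) p \<rho>(2) L in \<open>simp_all add: \<sigma>3_def\<close>)
  then have 3: "ensures (T + 4 * R + 4) (h R 0)
      ([Assign 12 (Lit 0), Assign 13 (Var 3), While (Less (Lit 0) (Var 13)) (vote x e v),
        Assign v (Less (Lit 0) (Var 12))] @ Q, \<sigma>2, L)"
    using frame \<sigma>(2) by (auto intro!: ensures_Assign simp: \<sigma>3_def \<sigma>2_def \<sigma>1_def)
  have "exec n g (rev_append x 11) \<sigma>1 (3 * length pre + 1) \<sigma>2"
    unfolding \<sigma>2_def \<rho>(1) using frame by (intro exec_rev_append) (auto simp: \<sigma>1_def)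
  then have "ensures (T + 4 * R + 4 + (3 * n + 1)) (h R 0) (rev_append x 11 @
      [Assign 12 (Lit 0), Assign 13 (Var 3), While (Less (Lit 0) (Var 13)) (vote x e v),
        Assign v (Less (Lit 0) (Var 12))] @ Q, \<sigma>1, L)"
    by (rule ensures_exec) (use len in simp, rule ensures_mono[OF 3], use len in simp_all)
  then have "ensures (T + 4 * R + 3 * n + 7) (h R 0) (test_child x b e v @ Q, \<sigma>, L)"
    unfolding test_child_def append_assoc append_Cons append_Nil
    using frame \<sigma>(1) by (intro ensures_Assign) (auto simp: \<sigma>1_def add_ac)
  then show ?thesis
    by (rule ensures_mono[OF _ order_refl h(3)])
qed


text \<open>After a wrong left verdict the trivial bound 1 suffices for the rest, so the costs
  \<open>\<theta> ^ R\<close> of the two tests just add up.\<close>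

lemma ensures_test_children:
  assumes \<sigma>: "\<sigma> 6 = enc_item (Task pre (b0 # suf) s s1 r p)" "\<sigma> 3 = Num (real R)"
    and \<rho>: "rev pre @ b0 # suf \<in> restrictions n" and s: "s1 < s" "s \<le> S"
    and p: "p_min \<le> p" "p < 1" and a: "0 \<le> a"
    and L: "\<And>c. c \<in> set L \<Longrightarrow> ok_call c"
    and cont: "\<And>\<tau> L' d1 d2. (\<And>y. y \<notin> {7..13} \<Longrightarrow> \<tau> y = \<sigma> y) \<Longrightarrow>
      \<tau> 7 = enc_point (rev pre @ -1 # suf) \<Longrightarrow> \<tau> 8 = enc_point (rev pre @ 1 # suf) \<Longrightarrow>
      \<tau> 9 = Num (of_bool d1) \<Longrightarrow> \<tau> 10 = Num (of_bool d2) \<Longrightarrow>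
      length L' = length L + 2 * R \<Longrightarrow> (\<And>c. c \<in> set L' \<Longrightarrow> ok_call c) \<Longrightarrow>
      ensures T (if rightly s1 p (rev pre @ -1 # suf) d1 \<and> rightly (s - s1) p (rev pre @ 1 # suf) d2
        then a else 1) (Q, \<tau>, L')"
  shows "ensures (T + 8 * R + 6 * n + 14) (a + 2 * \<theta> ^ R)
    (test_child 7 (-1) eS1 9 @ test_child 8 1 (Minus eS eS1) 10 @ Q, \<sigma>, L)"
proof -
  have \<rho>': "rev pre @ real_of_int (-1) # suf \<in> restrictions n" "rev pre @ real_of_int 1 # suf \<in> restrictions n"
    using \<rho> by (auto simp: restrictions_def)
  have pos: "0 \<le> \<theta> ^ R"
    using \<omega> by simp
  have "ensures (T + 4 * R + 3 * n + 7 + 4 * R + 3 * n + 7) ((a + \<theta> ^ R) + \<theta> ^ R)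
      (test_child 7 (-1) eS1 9 @ test_child 8 1 (Minus eS eS1) 10 @ Q, \<sigma>, L)"
  proof (rule ensures_test_child[OF _ _ _ \<sigma> refl \<rho>'(1)])
    fix \<tau>1 L1 d1
    assume 1: "\<And>y. y \<notin> {7, 9, 11, 12, 13} \<Longrightarrow> \<tau>1 y = \<sigma> y"
      "\<tau>1 7 = enc_point (rev pre @ real_of_int (-1) # suf)" "\<tau>1 9 = Num (of_bool d1)"
      "length L1 = length L + R" "\<And>c. c \<in> set L1 \<Longrightarrow> ok_call c"
    define a' where "a' = (if rightly s1 p (rev pre @ real_of_int (-1) # suf) d1 then a else 1)"
    have \<tau>1: "\<tau>1 6 = enc_item (Task pre (b0 # suf) s s1 r p)" "\<tau>1 3 = Num (real R)"
      using 1(1) \<sigma> by auto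
    have "ensures (T + 4 * R + 3 * n + 7) (a' + \<theta> ^ R) (test_child 8 1 (Minus eS eS1) 10 @ Q, \<tau>1, L1)"
    proof (rule ensures_test_child[OF _ _ _ \<tau>1 refl \<rho>'(2)])
      fix \<tau>2 L2 d2
      assume 2: "\<And>y. y \<notin> {8, 10, 11, 12, 13} \<Longrightarrow> \<tau>2 y = \<tau>1 y"
        "\<tau>2 8 = enc_point (rev pre @ real_of_int 1 # suf)" "\<tau>2 10 = Num (of_bool d2)"
        "length L2 = length L1 + R" "\<And>c. c \<in> set L2 \<Longrightarrow> ok_call c"
      have "ensures T (if rightly s1 p (rev pre @ -1 # suf) d1 \<and> rightly (s - s1) p (rev pre @ 1 # suf) d2
          then a else 1) (Q, \<tau>2, L2)"
        by (rule cont) (use 1 2 in auto)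
      then show "ensures T (if rightly (s - s1) p (rev pre @ real_of_int 1 # suf) d2 then a' else 1) (Q, \<tau>2, L2)"
        by (rule ensures_mono) (auto simp: a'_def)
    qed (use 1 s p a \<tau>1 in \<open>auto simp: a'_def\<close>)
    then show "ensures (T + 4 * R + 3 * n + 7)
        (if rightly s1 p (rev pre @ real_of_int (- 1) # suf) d1 then a + \<theta> ^ R else 1)
        (test_child 8 1 (Minus eS eS1) 10 @ Q, \<tau>1, L1)"
      by (cases "rightly s1 p (rev pre @ real_of_int (- 1) # suf) d1")
        (auto simp: a'_def dest: ensures_one)
  qed (use s p a pos L \<sigma> in auto)
  then show ?thesis
    by (rule ensures_mono) auto
qed

lemma ensures_leaf:
  assumes \<sigma>: "\<sigma> 6 = enc_item (Task pre suf s s1 r p)"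
    and \<rho>: "rev pre @ suf \<in> restrictions n"
    and cont: "\<And>\<tau> x. x \<in> cube n \<Longrightarrow> (\<And>y. y \<notin> {5, 7, 11, 14, 15, 16} \<Longrightarrow> \<tau> y = \<sigma> y) \<Longrightarrow>
      \<tau> 5 = Cell (Num (g (fill (rev pre @ suf) x))) (\<sigma> 5) \<Longrightarrow> ensures T (h x) (Q, \<tau>, L)"
  shows "ensures (T + 12 * n + 9) ((\<Sum>x\<in>cube n. h x) / 2 ^ n) (leaf_code @ Q, \<sigma>, L)"
proof -
  let ?\<rho> = "rev pre @ suf"
  define \<sigma>1 where "\<sigma>1 = \<sigma>(7 := enc_point suf, 11 := enc_point pre)"
  define \<sigma>2 where "\<sigma>2 = \<sigma>1(7 := enc_point ?\<rho>, 11 := Num 0)"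
  define \<sigma>3 where "\<sigma>3 = \<sigma>2(15 := Num 0)"
  have len: "length ?\<rho> = n" "length pre \<le> n"
    using \<rho> by (auto simp: restrictions_def)
  have "ensures ((T + 3 * n + 4) + 6 * length ?\<rho> + 1) ((\<Sum>x\<in>cube (length ?\<rho>). h x) / 2 ^ length ?\<rho>)
      (While (IsCell (Var 7)) sample_step # Assign 14 (Lit 0) #
       rev_append 14 15 @ [Query 16 (Var 14), Assign 5 (MkCell (Var 16) (Var 5))] @ Q, \<sigma>3, L)"
  proof (rule ensures_sample)
    show "\<sigma>3 7 = enc_point ?\<rho>" "\<sigma>3 15 = enc_point []"
      by (simp_all add: \<sigma>3_def \<sigma>2_def)
  next
    fix x \<tau>
    assume *: "x \<in> cube (length ?\<rho>)" "\<And>z. z \<notin> {7, 15, 16} \<Longrightarrow> \<tau> z = \<sigma>3 z"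
      "\<tau> 15 = enc_point (rev (fill ?\<rho> x) @ [])"
    let ?y = "fill ?\<rho> x"
    have x: "x \<in> cube n" "?y \<in> cube n"
      using * \<rho> len by (auto intro: fill_cube)
    define \<tau>1 where "\<tau>1 = (\<tau>(14 := Num 0))(14 := enc_point ?y, 15 := Num 0)"
    have "ensures T (h x) (Q, \<tau>1(16 := Num (g ?y), 5 := Cell (Num (g ?y)) (\<sigma> 5)), L)"
      by (rule cont) (use x *(2) in \<open>auto simp: \<tau>1_def \<sigma>3_def \<sigma>2_def \<sigma>1_def\<close>)
    then have 1: "ensures (T + 2) (h x) ([Query 16 (Var 14), Assign 5 (MkCell (Var 16) (Var 5))] @ Q, \<tau>1, L)"
      using x *(2)[of 5] unfolding append_Cons append_Nil
      by (intro ensures_Query ensures_Assign) (auto simp: \<tau>1_def \<sigma>3_def \<sigma>2_def \<sigma>1_def)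
    have "exec n g (rev_append 14 15) (\<tau>(14 := Num 0)) (3 * length (rev ?y) + 1)
        ((\<tau>(14 := Num 0))(14 := enc_point (rev (rev ?y) @ []), 15 := Num 0))"
      by (rule exec_rev_append) (use *(3) in auto)
    then have "exec n g (rev_append 14 15) (\<tau>(14 := Num 0)) (3 * n + 1) \<tau>1"
      using x by (simp add: \<tau>1_def length_cube)
    then have "ensures (T + 3 * n + 3) (h x) (rev_append 14 15 @
        [Query 16 (Var 14), Assign 5 (MkCell (Var 16) (Var 5))] @ Q, \<tau>(14 := Num 0), L)"
      by (rule ensures_exec) (simp, rule ensures_mono[OF 1], simp_all)
    then show "ensures (T + 3 * n + 4) (h x) (Assign 14 (Lit 0) #
        rev_append 14 15 @ [Query 16 (Var 14), Assign 5 (MkCell (Var 16) (Var 5))] @ Q, \<tau>, L)"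
      by (intro ensures_Assign) (simp_all add: eval_nat_numeral)
  qed
  then have 1: "ensures (T + 9 * n + 5) ((\<Sum>x\<in>cube n. h x) / 2 ^ n)
      (While (IsCell (Var 7)) sample_step # Assign 14 (Lit 0) #
       rev_append 14 15 @ [Query 16 (Var 14), Assign 5 (MkCell (Var 16) (Var 5))] @ Q, \<sigma>3, L)"
    unfolding len(1) by (rule ensures_mono) auto
  have 2: "ensures (T + 9 * n + 6) ((\<Sum>x\<in>cube n. h x) / 2 ^ n)
      ([Assign 15 (Lit 0), While (IsCell (Var 7)) sample_step, Assign 14 (Lit 0)] @
       rev_append 14 15 @ [Query 16 (Var 14), Assign 5 (MkCell (Var 16) (Var 5))] @ Q, \<sigma>2, L)"
    unfolding append_Cons append_Nil
    using 1 by (intro ensures_Assign) (simp_all add: \<sigma>3_def eval_nat_numeral)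
  have "exec n g (rev_append 7 11) \<sigma>1 (3 * length pre + 1) \<sigma>2"
    unfolding \<sigma>2_def by (intro exec_rev_append) (auto simp: \<sigma>1_def)
  then have "ensures (T + 9 * n + 6 + (3 * n + 1)) ((\<Sum>x\<in>cube n. h x) / 2 ^ n)
      (rev_append 7 11 @ [Assign 15 (Lit 0), While (IsCell (Var 7)) sample_step, Assign 14 (Lit 0)] @
       rev_append 14 15 @ [Query 16 (Var 14), Assign 5 (MkCell (Var 16) (Var 5))] @ Q, \<sigma>1, L)"
    by (rule ensures_exec) (use len in simp, rule ensures_mono[OF 2], use len in simp_all)
  then show ?thesis
    unfolding leaf_code_def append_assoc append_Cons append_Nil
    using \<sigma> by (intro ensures_Assign) (auto simp: \<sigma>1_def add_ac)
qed

section \<open>Worklist invariants and the error budget\<close>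

text \<open>One unit of size pays for a split: \<open>2 * n * S\<close> for the scans over the
  variables in both children, \<open>S + 1\<close> for their size counters and the
  \<open>Build\<close> item.\<close>

definition max_weight :: nat where
  "max_weight = 2 * n * S + S + 1"

text \<open>The weight bounds the number of iterations that an item can cause: at most \<open>n * S\<close> candidates at
  each of the at most \<open>2 * s - 1\<close> nodes.\<close>

fun weight :: "item \<Rightarrow> nat" where
  "weight (Task pre suf s s1 r p) = (s - 1) * max_weight + length suf * S + (s - s1) + 1"
| "weight (Build i) = 1"

fun item_size :: "item \<Rightarrow> nat" where
  "item_size (Task pre suf s s1 r p) = s"
| "item_size (Build i) = 0"

text \<open>Holds on every run, whatever the verdicts. The equation ties \<open>p\<close> to the
  remaining depth and so bounds it by \<open>P\<close>; for \<open>s = 1\<close> the counter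
  \<open>s1 = 1\<close> is already exhausted.\<close>

fun safe_item :: "item \<Rightarrow> bool" where
  "safe_item (Task pre suf s s1 r p) \<longleftrightarrow>
    rev pre @ suf \<in> restrictions n \<and> 1 \<le> s \<and> s \<le> S \<and> 1 \<le> s1 \<and> (s1 < s \<or> s1 = 1) \<and>
    p_min \<le> p \<and> p * 2 ^ (j * r) = P"
| "safe_item (Build i) \<longleftrightarrow> True"

definition viable :: "point \<Rightarrow> nat \<Rightarrow> real \<Rightarrow> nat \<Rightarrow> nat \<Rightarrow> bool" where
  "viable \<rho> s p i s1 \<longleftrightarrow> i < n \<and> \<rho> ! i = 0 \<and> 1 \<le> s1 \<and> s1 < s \<and>
    tree_close n s1 p (restr (\<rho>[i := -1])) \<and> tree_close n (s - s1) p (restr (\<rho>[i := 1]))"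

text \<open>The distance is \<open>p / 2\<close> because a split may double it, and doubled it still
  obliges the tests with parameter \<open>p\<close> to accept. The second part records that no
  candidate scanned so far was one they had to accept.\<close>

fun good_item :: "item \<Rightarrow> bool" where
  "good_item (Task pre suf s s1 r p) \<longleftrightarrow>
    tree_close n s (p / 2) (restr (rev pre @ suf)) \<and>
    (\<forall>i t. i < length pre \<or> i = length pre \<and> t < s1 \<longrightarrow> \<not> viable (rev pre @ suf) s p i t)"
| "good_item (Build i) \<longleftrightarrow> True"

text \<open>The summand \<open>s / 2 ^ r\<close> pays for the nodes that are cut off at the maximal depth.\<close>

definition achieves :: "point \<Rightarrow> nat \<Rightarrow> nat \<Rightarrow> dtree \<Rightarrow> bool" where
  "achieves \<rho> s r T \<longleftrightarrow> wf_dtree n T \<and>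
    cube_prob n (\<lambda>x. dt_eval T (fill \<rho> x) \<noteq> g (fill \<rho> x)) \<le> real s / 2 ^ r + P"

text \<open>Whatever trees are found for the tasks in \<open>W\<close>, if they are accurate enough then the rest of the
  computation assembles them into a tree that is close to \<open>g\<close>.\<close>

fun completes :: "item list \<Rightarrow> dtree list \<Rightarrow> bool" where
  "completes [] Ts \<longleftrightarrow> (\<exists>T. Ts = [T] \<and> wf_dtree n T \<and> close n \<epsilon> (dt_eval T) g)"
| "completes (Task pre suf s s1 r p # W) Ts \<longleftrightarrow>
    (\<forall>T. achieves (rev pre @ suf) s r T \<longrightarrow> completes W (T # Ts))"
| "completes (Build i # W) (b # a # Ts) \<longleftrightarrow> completes W (DNode i a b # Ts)"
| "completes (Build i # W) Ts \<longleftrightarrow> False"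

definition good :: "store \<Rightarrow> item list \<Rightarrow> bool" where
  "good \<sigma> W \<longleftrightarrow> (\<exists>Ts. \<sigma> 5 = enc_list (map enc_dtree Ts) \<and> completes W Ts) \<and> (\<forall>w\<in>set W. good_item w)"

text \<open>One unit of weight pays for the two tests of an iteration, one unit of size for the
  sample at a leaf; a split preserves the total size.\<close>

definition budget :: "item list \<Rightarrow> real" where
  "budget W = 2 * \<theta> ^ R * real (\<Sum>w\<leftarrow>W. weight w) + P * real (\<Sum>w\<leftarrow>W. item_size w)"

lemma budget_nonneg: "0 \<le> budget W"
  using \<omega> P by (simp add: budget_def)

text \<open>Every iteration lowers the total weight, which leaves room for its at most 6 units of
  stack growth and \<open>2 * R\<close> calls.\<close>

definition invariant :: "item list \<Rightarrow> store \<Rightarrow> call list \<Rightarrow> bool" where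
  "invariant W \<sigma> L \<longleftrightarrow> \<sigma> 3 = Num (real R) \<and> \<sigma> 4 = enc_list (map enc_item W) \<and>
    (\<forall>w\<in>set W. safe_item w) \<and> vsize (\<sigma> 5) + 6 * (\<Sum>w\<leftarrow>W. weight w) \<le> V \<and>
    length L + 2 * R * (\<Sum>w\<leftarrow>W. weight w) \<le> m \<and> (\<forall>c\<in>set L. ok_call c)"

lemma power_factor_le: "p * 2 ^ (j * r) = P \<Longrightarrow> p \<le> P"
  using P by (smt (verit) mult_le_cancel_left1 mult_nonneg_nonpos2 one_le_power zero_le_power)

text \<open>At \<open>r = 0\<close> the allowance \<open>s / 2 ^ r\<close> is at least 1, and any
  leaf will do. Otherwise all candidates are exhausted, none was viable, and
  \<open>close_tree_split\<close> at distance \<open>p / 2\<close> leaves only the constant case; a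
  sample misses the constant with probability at most \<open>p / 2\<close>.\<close>

lemma leaf_achieves:
  assumes "safe_item (Task pre suf s s1 r p)" "good_item (Task pre suf s s1 r p)"
    and "suf = [] \<or> r = 0 \<or> \<not> s1 < s"
  shows "\<exists>wrong. cube_prob n wrong \<le> P \<and> (\<forall>x\<in>cube n. \<not> wrong x \<longrightarrow>
    achieves (rev pre @ suf) s r (DLeaf (g (fill (rev pre @ suf) x))))"
proof -
  let ?\<rho> = "rev pre @ suf"
  have \<rho>: "?\<rho> \<in> restrictions n" and s: "1 \<le> s" and p: "p \<le> P" "0 < p"
    using assms(1) power_factor_le p_min by auto
  have val: "g (fill ?\<rho> x) \<in> {-1, 1}" if "x \<in> cube n" for x
    using bool_fun_restr[OF \<rho>] that by (auto simp: bool_fun_def)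
  show ?thesis
  proof (cases "r = 0")
    case True
    have "cube_prob n Q \<le> real s + P" for Q
      using cube_prob_le_1[of n Q] s P by linarith
    then show ?thesis
      using True val P by (intro exI[of _ "\<lambda>_. False"]) (simp add: achieves_def cube_prob_def)
  next
    case False
    obtain T where T: "wf_dtree n T" "num_leaves T \<le> s" "close n (p / 2) (restr ?\<rho>) (dt_eval T)"
      using assms(2) by (auto simp: tree_close_def dtrees_def)
    have "\<not> viable ?\<rho> s p i t" for i t
    proof
      assume v: "viable ?\<rho> s p i t"
      then have "i < length pre \<or> i = length pre \<and> t < s1"
        using assms(1,3) False \<rho> by (auto simp: viable_def restrictions_def)
      then show False
        using assms(2) v by auto
    qed
    then obtain b where b: "b \<in> {-1, 1}" "close n (p / 2) (restr ?\<rho>) (\<lambda>_. b)"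
      using close_tree_split[OF \<rho> T] by (auto simp: viable_def)
    have "achieves ?\<rho> s r (DLeaf b)"
    proof -
      have "cube_prob n (\<lambda>x. b \<noteq> g (fill ?\<rho> x)) \<le> p / 2"
        using b(2) by (simp add: close_iff_cube_prob eq_commute)
      moreover have "0 \<le> real s / 2 ^ r"
        by simp
      ultimately have "cube_prob n (\<lambda>x. b \<noteq> g (fill ?\<rho> x)) \<le> real s / 2 ^ r + P"
        using p by linarith
      then show ?thesis
        using b(1) by (simp add: achieves_def)
    qed
    then show ?thesis
      using b(2) p by (intro exI[of _ "\<lambda>x. g (fill ?\<rho> x) \<noteq> b"]) (auto simp: close_iff_cube_prob)
  qed
qed

text \<open>Averaging turns \<open>(s1 + (s - s1)) / 2 ^ (r - 1)\<close> into
  \<open>s / 2 ^ r\<close>, and the average of \<open>P\<close> and \<open>P\<close> is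
  \<open>P\<close>: the leaf error does not accumulate over the levels.\<close>

lemma node_achieves:
  assumes "\<rho> \<in> restrictions n" "i < n" "\<rho> ! i = 0" "s1 \<le> s" "0 < r"
    and "achieves (\<rho>[i := -1]) s1 (r - 1) T1" "achieves (\<rho>[i := 1]) (s - s1) (r - 1) T2"
  shows "achieves \<rho> s r (DNode i T1 T2)"
proof -
  obtain r' where r: "r = Suc r'"
    using assms(5) by (cases r) auto
  have "real s1 / 2 ^ r' + real (s - s1) / 2 ^ r' = 2 * (real s / 2 ^ r)"
    using assms(4) by (simp add: r of_nat_diff field_simps)
  then show ?thesis
    using assms unfolding achieves_def node_error[OF assms(1-3)] r by auto
qed


section \<open>Progress for each kind of work item\<close>

abbreviation total_weight :: "item list \<Rightarrow> nat" where
  "total_weight W \<equiv> \<Sum>w\<leftarrow>W. weight w"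

definition bound :: "store \<Rightarrow> item list \<Rightarrow> real" where
  "bound \<sigma> W = (if good \<sigma> W then budget W else 1)"

definition popped :: "item \<Rightarrow> item list \<Rightarrow> store \<Rightarrow> store" where
  "popped w W \<sigma> = \<sigma>(6 := enc_item w, 4 := enc_list (map enc_item W))"

lemma weight_pos: "1 \<le> weight w"
  by (cases w) auto

lemma ensures_build:
  assumes invariant: "invariant (Build i # W) \<sigma> L"
    and IH: "\<And>W' \<tau> L'. total_weight W' < total_weight (Build i # W) \<Longrightarrow> invariant W' \<tau> L' \<Longrightarrow>
      ensures T (bound \<tau> W') (Q, \<tau>, L')"
  shows "ensures (T + 1) (bound \<sigma> (Build i # W)) (build_code @ Q, popped (Build i) W \<sigma>, L)"
proof -
  let ?v = "Cell (Cell (Num (real i)) (Cell (head (tail (\<sigma> 5))) (head (\<sigma> 5)))) (tail (tail (\<sigma> 5)))"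
  define \<tau> where "\<tau> = (popped (Build i) W \<sigma>)(5 := ?v)"
  \<comment> \<open>The height of the stack is not part of the invariant; missing entries read as
    \<open>Num 0\<close>, and the constant 6 is what an empty stack needs.\<close>
  have size: "vsize ?v \<le> vsize (\<sigma> 5) + 6"
  proof (cases "\<sigma> 5")
    case (Cell u v)
    then show ?thesis
      by (cases v) auto
  qed simp
  have "invariant W \<tau> L"
    using invariant size by (auto simp: invariant_def \<tau>_def popped_def algebra_simps)
  then have "ensures T (bound \<tau> W) (Q, \<tau>, L)"
    by (intro IH) auto
  moreover have "good \<tau> W" if good: "good \<sigma> (Build i # W)"
  proof -
    obtain Ts where Ts: "\<sigma> 5 = enc_list (map enc_dtree Ts)" "completes (Build i # W) Ts"
      using good by (auto simp: good_def)
    then obtain b a Us where "Ts = b # a # Us" "completes W (DNode i a b # Us)"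
      by (cases "(Build i # W, Ts)" rule: completes.cases) auto
    then show ?thesis
      using good Ts(1) unfolding good_def
      by (intro conjI exI[of _ "DNode i a b # Us"]) (auto simp: \<tau>_def)
  qed
  moreover have "budget W \<le> budget (Build i # W)"
    using \<omega> by (simp add: budget_def algebra_simps)
  ultimately have "ensures T (bound \<sigma> (Build i # W)) (Q, \<tau>, L)"
    by (auto simp: bound_def elim: ensures_mono dest: ensures_one)
  then show ?thesis
    by (auto simp: build_code_def \<tau>_def popped_def intro!: ensures_Assign)
qed

lemma ensures_leaf_item:
  fixes pre suf s s1 r p
  defines "w \<equiv> Task pre suf s s1 r p"
  assumes invariant: "invariant (w # W) \<sigma> L" and stop: "suf = [] \<or> r = 0 \<or> \<not> s1 < s"
    and IH: "\<And>W' \<tau> L'. total_weight W' < total_weight (w # W) \<Longrightarrow> invariant W' \<tau> L' \<Longrightarrow>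
      ensures T (bound \<tau> W') (Q, \<tau>, L')"
  shows "ensures (T + 12 * n + 9) (bound \<sigma> (w # W)) (leaf_code @ Q, popped w W \<sigma>, L)"
proof -
  let ?\<rho> = "rev pre @ suf"
  have safe: "safe_item w"
    using invariant by (simp add: invariant_def)
  then have \<rho>: "?\<rho> \<in> restrictions n" and s: "1 \<le> s"
    by (auto simp: w_def)
  obtain wrong where wrong: "good \<sigma> (w # W) \<Longrightarrow> cube_prob n wrong \<le> P"
    "\<And>x. good \<sigma> (w # W) \<Longrightarrow> x \<in> cube n \<Longrightarrow> \<not> wrong x \<Longrightarrow> achieves ?\<rho> s r (DLeaf (g (fill ?\<rho> x)))"
  proof (cases "good \<sigma> (w # W)")
    case True
    then have "good_item w"
      by (simp add: good_def)
    then show ?thesis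
      using leaf_achieves[OF safe[unfolded w_def] _ stop] that by (auto simp: w_def)
  qed auto
  \<comment> \<open>A wrong sample is charged 1, so the mean charge is
    \<open>cube_prob n wrong\<close>, at most \<open>P\<close>, which the size of the item
    covers.\<close>
  define h where "h x = (if good \<sigma> (w # W) then budget W + of_bool (wrong x) else 1)" for x
  have "ensures (T + 12 * n + 9) ((\<Sum>x\<in>cube n. h x) / 2 ^ n) (leaf_code @ Q, popped w W \<sigma>, L)"
  proof (rule ensures_leaf[OF _ \<rho>])
    fix \<tau> x
    assume x: "x \<in> cube n" and frame: "\<And>y. y \<notin> {5, 7, 11, 14, 15, 16} \<Longrightarrow> \<tau> y = popped w W \<sigma> y"
      and 5: "\<tau> 5 = Cell (Num (g (fill ?\<rho> x))) (popped w W \<sigma> 5)"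
    have "invariant W \<tau> L"
      using invariant weight_pos[of w] by (auto simp: invariant_def frame 5 popped_def algebra_simps)
    then have ensures: "ensures T (bound \<tau> W) (Q, \<tau>, L)"
      using weight_pos[of w] by (intro IH) auto
    show "ensures T (h x) (Q, \<tau>, L)"
    proof (cases "good \<sigma> (w # W) \<and> \<not> wrong x")
      case True
      then obtain Ts where Ts: "\<sigma> 5 = enc_list (map enc_dtree Ts)" "completes (w # W) Ts"
        by (auto simp: good_def)
      have "completes W (DLeaf (g (fill ?\<rho> x)) # Ts)"
        using Ts(2) wrong(2) True x by (auto simp: w_def)
      then have "good \<tau> W"
        using True Ts(1) unfolding good_def
        by (intro conjI exI[of _ "DLeaf (g (fill ?\<rho> x)) # Ts"]) (auto simp: 5 popped_def)
      then show ?thesis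
        using ensures True by (simp add: h_def bound_def)
    next
      case False
      then show ?thesis
        using budget_nonneg[of W] by (auto simp: h_def intro: ensures_mono[OF ensures_one[OF ensures]] ensures_one[OF ensures])
    qed
  qed (simp add: popped_def w_def)
  moreover have "(\<Sum>x\<in>cube n. h x) / 2 ^ n \<le> bound \<sigma> (w # W)"
  proof (cases "good \<sigma> (w # W)")
    case True
    have "(\<Sum>x\<in>cube n. h x) / 2 ^ n = budget W + cube_prob n wrong"
      using True by (simp add: h_def sum.distrib cube_prob_eq_sum card_cube add_divide_distrib)
    also have "\<dots> \<le> budget W + P * real (item_size w)"
    proof -
      have "P * 1 \<le> P * real s"
        using s P by (intro mult_left_mono) auto
      then show ?thesis
        using wrong(1)[OF True] by (simp add: w_def)
    qed
    also have "\<dots> \<le> budget (w # W)"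
      using \<omega> by (simp add: budget_def algebra_simps)
    finally show ?thesis
      using True by (simp add: bound_def)
  qed (simp add: h_def bound_def card_cube)
  ultimately show ?thesis
    by (rule ensures_mono[OF _ order_refl])
qed

text \<open>Both children restart the scan at the first variable. The factor of
  \<open>max_weight\<close> is \<open>s - 1\<close> and not \<open>s\<close>, so that a split frees
  one such unit: \<open>(s1 - 1) + (s - s1 - 1)\<close> is one less than
  \<open>s - 1\<close>.\<close>

lemma weight_split:
  assumes "1 \<le> s1" "s1 < s" "s \<le> S" "length pre + 1 + length suf = n"
  shows "weight (Task [] (rev pre @ b # suf) s1 1 r p) + weight (Task [] (rev pre @ b' # suf) (s - s1) 1 r p)
    + 1 < weight (Task pre (b0 # suf) s s1 r' p')"
proof -
  obtain a b where ab: "s1 = Suc a" "s = s1 + Suc b"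
    using assms by (metis Suc_le_D One_nat_def less_imp_Suc_add add_Suc_right)
  have "length pre + (1 + length suf) = n"
    using assms by simp
  then have len: "length (rev pre @ x # suf) = n" for x
    by simp
  have "weight (Task [] (rev pre @ x # suf) t 1 r p) = (t - 1) * max_weight + n * S + (t - 1) + 1" for x t
    by (simp only: weight.simps len)
  then show ?thesis
    using assms ab by (simp add: max_weight_def algebra_simps)
qed

lemma ensures_search:
  fixes pre b0 suf s s1 r p
  defines "w \<equiv> Task pre (b0 # suf) s s1 r p"
  assumes invariant: "invariant (w # W) \<sigma> L" and go: "0 < r" "s1 < s"
    and IH: "\<And>W' \<tau> L'. total_weight W' < total_weight (w # W) \<Longrightarrow> invariant W' \<tau> L' \<Longrightarrow>
      ensures T (bound \<tau> W') (Q, \<tau>, L')"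
  shows "ensures (T + 8 * R + 6 * n + 17) (bound \<sigma> (w # W)) (search_code j @ Q, popped w W \<sigma>, L)"
proof -
  let ?\<rho> = "rev pre @ b0 # suf" and ?i = "length pre"
  let ?\<rho>1 = "rev pre @ -1 # suf" and ?\<rho>2 = "rev pre @ 1 # suf"
  have "safe_item w"
    using invariant by (simp add: invariant_def)
  then have \<rho>: "?\<rho> \<in> restrictions n" and s: "1 \<le> s1" "s \<le> S" and p: "p_min \<le> p" "p * 2 ^ (j * r) = P"
    by (auto simp: w_def)
  then have p': "p < 1" "0 < p" and len: "length pre + 1 + length suf = n"
    and \<rho>12: "?\<rho>1 \<in> restrictions n" "?\<rho>2 \<in> restrictions n"
    using power_factor_le[of p r] P p_min by (auto simp: restrictions_def)
  have upd: "?\<rho>[?i := -1] = ?\<rho>1" "?\<rho>[?i := 1] = ?\<rho>2" "?\<rho> ! ?i = b0"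
    by (simp_all add: list_update_append nth_append)
  obtain r' where r: "r = Suc r'"
    using go by (cases r) auto
  \<comment> \<open>What remains of the budget once the two tests of this iteration are paid
    for.\<close>
  define a where "a = (if good \<sigma> (w # W) then budget (w # W) - 2 * \<theta> ^ R else 1)"
  have pos: "0 \<le> \<theta> ^ R"
    using \<omega> by simp
  have drop: "budget W' \<le> budget (w # W) - 2 * \<theta> ^ R"
    if "total_weight W' < total_weight (w # W)" "(\<Sum>w\<leftarrow>W'. item_size w) \<le> (\<Sum>w\<leftarrow>w # W. item_size w)" for W'
  proof -
    have "2 * \<theta> ^ R * (real (total_weight W') + 1) \<le> 2 * \<theta> ^ R * real (total_weight (w # W))"
      using that(1) pos by (intro mult_left_mono) auto
    moreover have "P * real (\<Sum>w\<leftarrow>W'. item_size w) \<le> P * real (\<Sum>w\<leftarrow>w # W. item_size w)"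
      using that(2) P by (intro mult_left_mono) (simp_all only: of_nat_le_iff)
    ultimately show ?thesis
      unfolding budget_def by (simp only: distrib_left mult_1_right)
  qed
  have a: "0 \<le> a"
  proof -
    have "0 \<le> budget (w # W) - 2 * \<theta> ^ R"
      using drop[of "[]"] weight_pos[of w] by (simp add: budget_def)
    then show ?thesis
      by (simp add: a_def)
  qed
  have "ensures ((T + 3) + 8 * R + 6 * n + 14) (a + 2 * \<theta> ^ R)
      (test_child 7 (-1) eS1 9 @ test_child 8 1 (Minus eS eS1) 10 @
        decide_code j @ Q,
       popped w W \<sigma>, L)"
  proof (rule ensures_test_children[OF _ _ \<rho> go(2) s(2) p(1) p'(1) a])
    show "popped w W \<sigma> 6 = enc_item (Task pre (b0 # suf) s s1 r p)"
      by (simp add: popped_def w_def)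
    show "popped w W \<sigma> 3 = Num (real R)"
      using invariant by (simp add: popped_def invariant_def)
    show "ok_call c" if "c \<in> set L" for c
      using invariant that by (simp add: invariant_def)
  next
    fix \<tau> L' d1 d2
    assume frame: "\<And>y. y \<notin> {7..13} \<Longrightarrow> \<tau> y = popped w W \<sigma> y"
      and regs: "\<tau> 7 = enc_point ?\<rho>1" "\<tau> 8 = enc_point ?\<rho>2"
        "\<tau> 9 = Num (of_bool d1)" "\<tau> 10 = Num (of_bool d2)"
      and L': "length L' = length L + 2 * R" "\<And>c. c \<in> set L' \<Longrightarrow> ok_call c"
    define rt where "rt \<longleftrightarrow> rightly s1 p ?\<rho>1 d1 \<and> rightly (s - s1) p ?\<rho>2 d2"
    have 6: "\<tau> 6 = enc_item w" and 5: "\<tau> 5 = \<sigma> 5" and 4: "\<tau> 4 = enc_list (map enc_item W)"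
      and 3: "\<tau> 3 = Num (real R)"
      using frame[of 6] frame[of 5] frame[of 4] frame[of 3] invariant by (simp_all add: popped_def invariant_def)
    have next_invariant: "invariant (U @ W) (\<tau>(4 := v)) L'"
      if "total_weight U < weight w" "v = enc_list (map enc_item (U @ W))" "\<forall>u\<in>set U. safe_item u" for U v
    proof -
      have "2 * R + 2 * R * total_weight U \<le> 2 * R * weight w"
        using mult_le_mono2[of "Suc (total_weight U)" "weight w" "2 * R"] that(1) by simp
      then show ?thesis
        using invariant that 3 5 L' by (auto simp: invariant_def algebra_simps)
    qed
    \<comment> \<open>Common to the three possible successors \<open>U\<close> of the item: they
      must be lighter, safe and of no larger total size on every run, and inherit goodness when both
      verdicts are right.\<close>
    have ensures: "ensures T (if rt then a else 1) (Q, \<tau>(4 := v), L')"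
      if U: "total_weight U < weight w" "v = enc_list (map enc_item (U @ W))" "\<forall>u\<in>set U. safe_item u"
        "(\<Sum>u\<leftarrow>U. item_size u) \<le> s"
        and good: "rt \<Longrightarrow> good_item w \<Longrightarrow> \<forall>u\<in>set U. good_item u"
        "\<And>Ts. completes (w # W) Ts \<Longrightarrow> completes (U @ W) Ts" for U v
    proof -
      have ensures: "ensures T (bound (\<tau>(4 := v)) (U @ W)) (Q, \<tau>(4 := v), L')"
        using U next_invariant[OF U(1-3)] by (intro IH) auto
      show ?thesis
      proof (cases "rt \<and> good \<sigma> (w # W)")
        case True
        then have "good (\<tau>(4 := v)) (U @ W)"
          using good 5 by (auto simp: good_def)
        moreover have "budget (U @ W) \<le> budget (w # W) - 2 * \<theta> ^ R"
          using U by (intro drop) (auto simp: w_def)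
        ultimately show ?thesis
          using ensures True by (auto simp: bound_def a_def elim: ensures_mono)
      next
        case False
        then show ?thesis
          using ensures_one[OF ensures] by (auto simp: a_def)
      qed
    qed
    let ?c1 = "Less (Lit 1) (Minus (Plus (Var 9) (Var 10)) (nonzero (Head eSuf)))"
    let ?c2 = "Less (Plus eS1 (Lit 1)) eS"
    let ?e1 = "MkCell (mk_task eS1 (Lit 1) (Minus eR (Lit 1)) (mult_expr (2 ^ j) eP) (Lit 0) (Lit 0) (Var 7))
      (MkCell (mk_task (Minus eS eS1) (Lit 1) (Minus eR (Lit 1)) (mult_expr (2 ^ j) eP)
        (Lit 0) (Lit 0) (Var 8)) (MkCell eI (Var 4)))"
    let ?e2 = "MkCell (mk_task eS (Plus eS1 (Lit 1)) eR eP eI ePre eSuf) (Var 4)"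
    let ?e3 = "MkCell (mk_task eS (Lit 1) eR eP (Plus eI (Lit 1)) (MkCell (Head eSuf) ePre) (Tail eSuf)) (Var 4)"
    let ?If = "If ?c1 [Assign 4 ?e1] [If ?c2 [Assign 4 ?e2] [Assign 4 ?e3]]"
    have code: "decide_code j = [?If]"
      by (simp add: decide_code_def)
    have "b0 = -1 \<or> b0 = 0 \<or> b0 = 1"
      using \<rho> by (auto simp: restrictions_def)
    then have cond: "holds ?c1 \<tau> \<longleftrightarrow> d1 \<and> d2 \<and> b0 = 0"
      by (auto simp: holds_def 6 w_def regs)
    have fail: "\<not> viable ?\<rho> s p ?i s1" if "rt" "\<not> (d1 \<and> d2 \<and> b0 = 0)"
      unfolding viable_def upd using that by (auto simp: rt_def rightly_def viable_def)
    have "ensures (T + 3) (if rt then a else 1) (?If # Q, \<tau>, L')"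
    proof (cases "d1 \<and> d2 \<and> b0 = 0")
      case True
      let ?U = "[Task [] ?\<rho>1 s1 1 r' (2 ^ j * p), Task [] ?\<rho>2 (s - s1) 1 r' (2 ^ j * p), Build ?i]"
      have "?i < n"
        using len by simp
      then have node: "achieves ?\<rho> s r (DNode ?i T1 T2)"
        if "achieves ?\<rho>1 s1 r' T1" "achieves ?\<rho>2 (s - s1) r' T2" for T1 T2
        using node_achieves[OF \<rho> _ _ _ go(1), of ?i s1 s T1 T2] that upd go True r by simp
      \<comment> \<open>Acceptance certifies distance \<open>C * p\<close>; a good child task needs
        half of its own parameter \<open>2 ^ j * p\<close>.\<close>
      have Cp: "C * p \<le> 2 ^ j * p / 2"
        using C(2) p' by (simp add: field_simps)
      have "1 * p \<le> 2 ^ j * p"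
        using p' by (intro mult_right_mono) auto
      then have JU: "ensures T (if rt then a else 1) (Q, \<tau>(4 := enc_list (map enc_item (?U @ W))), L')"
      proof (intro ensures[OF _ refl])
        show "total_weight ?U < weight w"
          using weight_split[OF s(1) go(2) s(2) len] by (simp add: w_def)
        show "\<forall>u\<in>set ?U. safe_item u"
          using s go \<rho>12 p \<open>1 * p \<le> 2 ^ j * p\<close> by (auto simp: r power_add algebra_simps)
        show "\<forall>u\<in>set ?U. good_item u" if "rt"
          using that True tree_close_mono[OF _ Cp] by (auto simp: rt_def rightly_def viable_def)
        show "completes (?U @ W) Ts" if "completes (w # W) Ts" for Ts
          using that node by (auto simp: w_def)
      qed (use go in auto)
      have val: "expr_val ?e1 \<tau> = enc_list (map enc_item (?U @ W))"
        using go by (simp add: 6 4 w_def regs r expr_val_mult_expr of_nat_diff)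
      have "ensures T (if rt then a else 1) (Q, \<tau>(4 := expr_val ?e1 \<tau>), L')"
        unfolding val by (rule JU)
      from ensures_Assign_less[OF this, of "T + 1"] show ?thesis
        using True cond by (intro ensures_If_less[where T = "T + 1"]) simp_all
    next
      case False
      then have not_cond: "\<not> holds ?c1 \<tau>"
        using cond by simp
      show ?thesis
      proof (cases "s1 + 1 < s")
        case s1: True
        let ?U = "[Task pre (b0 # suf) s (s1 + 1) r p]"
        have JU: "ensures T (if rt then a else 1) (Q, \<tau>(4 := enc_list (map enc_item (?U @ W))), L')"
        proof (intro ensures[OF _ refl])
          show "\<forall>u\<in>set ?U. safe_item u"
            using s s1 \<rho> p by auto
          show "\<forall>u\<in>set ?U. good_item u" if "rt" "good_item w"
            using that(2) fail[OF that(1) False] by (auto simp: w_def less_Suc_eq)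
        qed (use go in \<open>auto simp: w_def\<close>)
        have val: "expr_val ?e2 \<tau> = enc_list (map enc_item (?U @ W))"
          by (simp add: 6 4 w_def add.commute)
        have "ensures T (if rt then a else 1) (Q, \<tau>(4 := expr_val ?e2 \<tau>), L')"
          unfolding val by (rule JU)
        from ensures_Assign_less[OF this, of "T + 1"]
        have "ensures (T + 2) (if rt then a else 1) (If ?c2 [Assign 4 ?e2] [Assign 4 ?e3] # Q, \<tau>, L')"
          using s1 by (intro ensures_If_less[where T = "T + 1"]) (simp_all add: holds_def 6 w_def)
        then show ?thesis
          using not_cond by (intro ensures_If_less[where T = "T + 2"]) simp_all
      next
        case s1: False
        let ?U = "[Task (b0 # pre) suf s 1 r p]"
        have JU: "ensures T (if rt then a else 1) (Q, \<tau>(4 := enc_list (map enc_item (?U @ W))), L')"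
        proof (intro ensures[OF _ refl])
          show "\<forall>u\<in>set ?U. safe_item u"
            using s go \<rho> p by auto
          show "\<forall>u\<in>set ?U. good_item u" if "rt" "good_item w"
          proof -
            \<comment> \<open>Here \<open>s1 + 1 = s\<close>, so every admissible left size for this
              variable has been refuted.\<close>
            have "0 < t \<and> (t < s1 \<or> t = s1)" if "viable ?\<rho> s p i t" for i t
              using that s1 by (auto simp: viable_def)
            then show ?thesis
              using that(2) fail[OF that(1) False] by (fastforce simp: w_def less_Suc_eq)
          qed
        qed (use go s in \<open>auto simp: w_def\<close>)
        have val: "expr_val ?e3 \<tau> = enc_list (map enc_item (?U @ W))"
          by (simp add: 6 4 w_def add.commute)
        have "ensures T (if rt then a else 1) (Q, \<tau>(4 := expr_val ?e3 \<tau>), L')"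
          unfolding val by (rule JU)
        from ensures_Assign_less[OF this, of "T + 1"]
        have "ensures (T + 2) (if rt then a else 1) (If ?c2 [Assign 4 ?e2] [Assign 4 ?e3] # Q, \<tau>, L')"
          using s1 by (intro ensures_If_less[where T = "T + 1"]) (simp_all add: holds_def 6 w_def)
        then show ?thesis
          using not_cond by (intro ensures_If_less[where T = "T + 2"]) simp_all
      qed
    qed
    then show "ensures (T + 3) (if rightly s1 p ?\<rho>1 d1 \<and> rightly (s - s1) p ?\<rho>2 d2 then a else 1)
        (decide_code j @ Q, \<tau>, L')"
      by (simp only: code rt_def append_Cons append_Nil)
  qed
  then have "ensures (T + 8 * R + 6 * n + 17) (a + 2 * \<theta> ^ R) (search_code j @ Q, popped w W \<sigma>, L)"
    unfolding search_code_def append_assoc by (rule ensures_mono) auto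
  then show ?thesis
    by (auto simp: bound_def a_def dest: ensures_one)
qed


section \<open>Running time and error of the main loop\<close>

text \<open>The larger coefficients of a search and of a leaf; 22 is the 17 of a search plus the
  loop test, two assignments and two conditionals.\<close>

definition iteration_time :: nat where
  "iteration_time = 8 * R + 12 * n + 22"

lemma ensures_iteration:
  assumes invariant: "invariant (w # W) \<sigma> L"
    and IH: "\<And>W' \<tau> L'. total_weight W' < total_weight (w # W) \<Longrightarrow> invariant W' \<tau> L' \<Longrightarrow>
      ensures T (bound \<tau> W') (Q, \<tau>, L')"
  shows "ensures (T + (8 * R + 12 * n + 21)) (bound \<sigma> (w # W)) (body_code j @ Q, \<sigma>, L)"
proof -
  let ?e = "Less (Lit 2) (Plus (IsCell eSuf) (Plus (Less (Lit 0) eR) (Less eS1 eS)))"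
  have "ensures (T + (8 * R + 12 * n + 18)) (bound \<sigma> (w # W))
      ((if holds (IsCell (Var 6)) (popped w W \<sigma>) then [If ?e (search_code j) leaf_code] else build_code)
        @ Q, popped w W \<sigma>, L)"
  proof (cases w)
    case (Build i)
    then show ?thesis
      using ensures_mono[OF ensures_build[OF invariant[unfolded Build]], of T Q] IH by (auto simp: popped_def holds_def)
  next
    case (Task pre suf s s1 r p)
    have cond: "holds ?e (popped w W \<sigma>) \<longleftrightarrow> suf \<noteq> [] \<and> 0 < r \<and> s1 < s"
      by (auto simp: holds_def popped_def Task is_cell_enc_point)
    have "ensures (T + (8 * R + 12 * n + 17)) (bound \<sigma> (w # W))
        ((if holds ?e (popped w W \<sigma>) then search_code j else leaf_code) @ Q, popped w W \<sigma>, L)"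
    proof (cases "suf \<noteq> [] \<and> 0 < r \<and> s1 < s")
      case True
      then obtain b0 suf' where suf: "suf = b0 # suf'"
        by (cases suf) auto
      have "ensures (T + 8 * R + 6 * n + 17) (bound \<sigma> (w # W)) (search_code j @ Q, popped w W \<sigma>, L)"
        unfolding Task suf
        by (rule ensures_search) (use True invariant IH in \<open>auto simp: Task suf\<close>)
      moreover have "holds ?e (popped w W \<sigma>)"
        using True cond by blast
      ultimately show ?thesis
        by (subst if_P) (auto elim: ensures_mono)
    next
      case False
      have "ensures (T + 12 * n + 9) (bound \<sigma> (w # W)) (leaf_code @ Q, popped w W \<sigma>, L)"
        unfolding Task
        by (rule ensures_leaf_item) (use False invariant IH in \<open>auto simp: Task\<close>)
      moreover have "\<not> holds ?e (popped w W \<sigma>)"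
        using False cond by blast
      ultimately show ?thesis
        by (subst if_not_P) (auto elim: ensures_mono)
    qed
    then have "ensures (T + (8 * R + 12 * n + 18)) (bound \<sigma> (w # W))
        (If ?e (search_code j) leaf_code # Q, popped w W \<sigma>, L)"
      by (intro ensures_If) (simp_all add: eval_nat_numeral)
    moreover have "holds (IsCell (Var 6)) (popped w W \<sigma>)"
      by (simp add: holds_def popped_def Task)
    ultimately show ?thesis
      by simp
  qed
  then have 1: "ensures (T + (8 * R + 12 * n + 19)) (bound \<sigma> (w # W))
      (If (IsCell (Var 6)) [If ?e (search_code j) leaf_code] build_code # Q, popped w W \<sigma>, L)"
    by (intro ensures_If) (simp_all add: eval_nat_numeral)
  have "(\<sigma>(6 := enc_item w))(4 := enc_list (map enc_item W)) = popped w W \<sigma>"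
    by (simp add: popped_def)
  moreover have "expr_val (Head (Var 4)) \<sigma> = enc_item w"
    "expr_val (Tail (Var 4)) (\<sigma>(6 := enc_item w)) = enc_list (map enc_item W)"
    using invariant by (simp_all add: invariant_def)
  ultimately show ?thesis
    using 1 unfolding body_code_def append_Cons append_Nil
    by (intro ensures_Assign) (simp_all add: eval_nat_numeral)
qed

lemma ensures_loop:
  assumes "invariant W \<sigma> L"
  shows "ensures (total_weight W * iteration_time + 2) (bound \<sigma> W)
    ([While (IsCell (Var 4)) (body_code j), Assign 0 (Head (Var 5))], \<sigma>, L)"
  using assms
proof (induction "total_weight W" arbitrary: W \<sigma> L rule: less_induct)
  case less
  show ?case
  proof (cases W)
    case Nil
    have size: "vsize (head (\<sigma> 5)) \<le> vsize (\<sigma> 5)"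
      by (cases "\<sigma> 5") auto
    have "ensures 0 (bound \<sigma> W) ([], \<sigma>(0 := head (\<sigma> 5)), L)"
    proof (rule ensures_Nil)
      show "([], \<sigma>(0 := head (\<sigma> 5)), L) \<in> safe"
        using less.prems size by (auto simp: safe_def invariant_def)
      \<comment> \<open>For the empty worklist \<open>completes\<close> is exactly the correctness
        of the output.\<close>
      show "([], \<sigma>(0 := head (\<sigma> 5)), L) \<in> bad \<longrightarrow> 1 \<le> bound \<sigma> W"
        by (auto simp: bad_def bound_def outputs_close_tree_def good_def Nil)
      show "0 \<le> bound \<sigma> W"
        by (simp add: bound_def budget_nonneg)
    qed
    then show ?thesis
      using less.prems by (auto simp: Nil invariant_def holds_def intro!: ensures_While_False ensures_Assign)
  next
    case (Cons w W')
    define M where "M = total_weight W - 1"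
    have M: "total_weight W = Suc M"
      using weight_pos[of w] by (simp add: M_def Cons)
    have "ensures (M * iteration_time + 2 + (8 * R + 12 * n + 21)) (bound \<sigma> W)
        (body_code j @ [While (IsCell (Var 4)) (body_code j), Assign 0 (Head (Var 5))], \<sigma>, L)"
      unfolding Cons
    proof (rule ensures_iteration)
      fix U \<tau> L'
      assume *: "total_weight U < total_weight (w # W')" "invariant U \<tau> L'"
      then have "total_weight U * iteration_time \<le> M * iteration_time"
        using M by (intro mult_le_mono1) (simp add: Cons)
      then show "ensures (M * iteration_time + 2) (bound \<tau> U)
          ([While (IsCell (Var 4)) (body_code j), Assign 0 (Head (Var 5))], \<tau>, L')"
        using * by (intro ensures_mono[OF less.hyps]) (auto simp: Cons)
    qed (use less.prems Cons in simp)
    moreover have "M * iteration_time + 2 + (8 * R + 12 * n + 21) = total_weight W * iteration_time + 2 - 1"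
      by (simp add: M iteration_time_def)
    ultimately have 1: "ensures (total_weight W * iteration_time + 2 - 1) (bound \<sigma> W)
        (body_code j @ [While (IsCell (Var 4)) (body_code j), Assign 0 (Head (Var 5))], \<sigma>, L)"
      by (simp only:)
    have 2: "holds (IsCell (Var 4)) \<sigma>"
      using less.prems by (simp add: Cons invariant_def holds_def)
    show ?thesis
      by (rule ensures_While_True[OF _ 2 1]) simp
  qed
qed

end

section \<open>Initialisation of the worklist\<close>

lemma exec_count_zeros:
  "\<sigma> 12 = Num (real k) \<Longrightarrow> \<sigma> 11 = enc_point a \<Longrightarrow>
    exec n g [While (Less (Lit 0) (Var 12))
      [Assign 11 (MkCell (Lit 0) (Var 11)), Assign 12 (Minus (Var 12) (Lit 1))]] \<sigma> (3 * k + 1)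
      (\<sigma>(11 := enc_point (replicate k 0 @ a), 12 := Num 0))"
proof (induction k arbitrary: \<sigma> a)
  case 0
  then have eq: "\<sigma>(11 := enc_point (replicate 0 0 @ a), 12 := Num 0) = \<sigma>"
    by auto
  show ?case
    using 0 by (subst eq) (auto simp: holds_def intro!: exec_While_False exec_Nil)
next
  case (Suc k)
  let ?l = "[Assign 11 (MkCell (Lit 0) (Var 11)), Assign 12 (Minus (Var 12) (Lit 1))]"
  let ?\<sigma>' = "\<sigma>(11 := enc_point (replicate (Suc k) 0 @ a), 12 := Num 0)"
  define \<tau> where "\<tau> = \<sigma>(11 := Cell (Num 0) (\<sigma> 11), 12 := Num (real k))"
  have "exec n g [While (Less (Lit 0) (Var 12)) ?l] \<tau> (3 * k + 1)
      (\<tau>(11 := enc_point (replicate k 0 @ 0 # a), 12 := Num 0))"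
    by (rule Suc.IH) (use Suc.prems in \<open>auto simp: \<tau>_def\<close>)
  moreover have "\<tau>(11 := enc_point (replicate k 0 @ 0 # a), 12 := Num 0) = ?\<sigma>'"
    by (auto simp: \<tau>_def replicate_app_Cons_same)
  ultimately have *: "exec n g [While (Less (Lit 0) (Var 12)) ?l] \<tau> (3 * k + 1) ?\<sigma>'"
    by simp
  have time: "3 * Suc k + 1 = Suc (Suc (Suc (3 * k + 1)))"
    by simp
  show ?case
    unfolding time
  proof (rule exec_While_True)
    show "holds (Less (Lit 0) (Var 12)) \<sigma>"
      using Suc.prems by (simp add: holds_def)
    show "exec n g (?l @ [While (Less (Lit 0) (Var 12)) ?l]) \<sigma> (Suc (Suc (3 * k + 1))) ?\<sigma>'"
      unfolding append_Cons append_Nil using * Suc.prems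
      by (intro exec_Assign) (simp add: \<tau>_def)
  qed
qed

text \<open>Repeated halving of \<open>x\<close> is how the program obtains a logarithm; by the
  assumption the guard fails first at \<open>D\<close>. The claim starts from an arbitrary round
  \<open>d\<close> to make the induction work.\<close>

lemma exec_count_depth:
  assumes "\<And>d. \<epsilon> < 2 * (x / 2 ^ d) \<longleftrightarrow> d < D"
  shows "d \<le> D \<Longrightarrow> \<sigma> 2 = Num \<epsilon> \<Longrightarrow> \<sigma> 9 = Num (x / 2 ^ d) \<Longrightarrow> \<sigma> 10 = Num (real d) \<Longrightarrow>
    \<sigma> 13 = Num (y / 2 ^ (Suc j * d)) \<Longrightarrow>
    exec n g [While (Less (Var 2) (Plus (Var 9) (Var 9)))
      [Assign 9 (Half (Var 9)), Assign 10 (Plus (Var 10) (Lit 1)),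
       Assign 13 (halve_expr (Suc j) (Var 13))]] \<sigma> (4 * (D - d) + 1)
      (\<sigma>(9 := Num (x / 2 ^ D), 10 := Num (real D), 13 := Num (y / 2 ^ (Suc j * D))))"
proof (induction "D - d" arbitrary: d \<sigma>)
  case 0
  then have d: "d = D"
    by simp
  have eq: "\<sigma>(9 := Num (x / 2 ^ D), 10 := Num (real D), 13 := Num (y / 2 ^ (Suc j * D))) = \<sigma>"
    using 0 d by (auto simp del: mult_Suc)
  show ?case
    using 0 assms[of d]
    by (subst eq) (auto simp: d holds_def simp del: mult_Suc intro!: exec_While_False exec_Nil)
next
  case (Suc k)
  let ?l = "[Assign 9 (Half (Var 9)), Assign 10 (Plus (Var 10) (Lit 1)),
       Assign 13 (halve_expr (Suc j) (Var 13))]"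
  let ?\<sigma>' = "\<sigma>(9 := Num (x / 2 ^ D), 10 := Num (real D), 13 := Num (y / 2 ^ (Suc j * D)))"
  define \<tau> where "\<tau> = \<sigma>(9 := Num (x / 2 ^ Suc d), 10 := Num (real (Suc d)),
    13 := Num (y / 2 ^ (Suc j * Suc d)))"
  have "exec n g [While (Less (Var 2) (Plus (Var 9) (Var 9))) ?l] \<tau> (4 * (D - Suc d) + 1)
      (\<tau>(9 := Num (x / 2 ^ D), 10 := Num (real D), 13 := Num (y / 2 ^ (Suc j * D))))"
    by (rule Suc.hyps(1)) (use Suc in \<open>auto simp: \<tau>_def simp del: mult_Suc mult_Suc_right\<close>)
  moreover have "\<tau>(9 := Num (x / 2 ^ D), 10 := Num (real D), 13 := Num (y / 2 ^ (Suc j * D))) = ?\<sigma>'"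
    by (auto simp: \<tau>_def)
  ultimately have *: "exec n g [While (Less (Var 2) (Plus (Var 9) (Var 9))) ?l] \<tau> (4 * (D - Suc d) + 1) ?\<sigma>'"
    by simp
  have time: "4 * (D - d) + 1 = Suc (Suc (Suc (Suc (4 * (D - Suc d) + 1))))"
    using Suc.hyps(2) by simp
  have "expr_val (halve_expr (Suc j) (Var 13)) (\<sigma>(9 := Num (x / 2 ^ Suc d), 10 := Num (real (Suc d)))) =
      Num (y / 2 ^ (Suc j * d) / 2 ^ Suc j)"
    by (rule expr_val_halve_expr) (use Suc.prems in simp)
  also have "y / 2 ^ (Suc j * d) / 2 ^ Suc j = y / 2 ^ (Suc j * Suc d)"
    by (simp add: power_add mult_ac)
  finally have 13: "expr_val (halve_expr (Suc j) (Var 13))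
      (\<sigma>(9 := Num (x / 2 ^ Suc d), 10 := Num (real (Suc d)))) = Num (y / 2 ^ (Suc j * Suc d))" .
  have 9: "expr_val (Half (Var 9)) \<sigma> = Num (x / 2 ^ Suc d)"
    "expr_val (Plus (Var 10) (Lit 1)) (\<sigma>(9 := Num (x / 2 ^ Suc d))) = Num (real (Suc d))"
    using Suc.prems by simp_all
  show ?case
    unfolding time
  proof (rule exec_While_True)
    show "holds (Less (Var 2) (Plus (Var 9) (Var 9))) \<sigma>"
      using Suc.prems Suc.hyps(2) assms[of d] by (simp add: holds_def)
    show "exec n g (?l @ [While (Less (Var 2) (Plus (Var 9) (Var 9))) ?l]) \<sigma>
        (Suc (Suc (Suc (4 * (D - Suc d) + 1)))) ?\<sigma>'"
      unfolding append_Cons append_Nil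
      by (intro exec_Assign) (simp only: 9 13 *[unfolded \<tau>_def])
  qed
qed

section \<open>Choice of the parameters\<close>

lemma exec_init:
  assumes D: "\<And>d. \<epsilon> < 2 * (real s / 2 ^ d) \<longleftrightarrow> d < D"
  shows "\<exists>\<sigma>. exec n g (init_code j q K) (init_store n s \<epsilon>) (4 * D + 3 * n + 7) \<sigma> \<and>
    \<sigma> 3 = Num (real (K * (n + s + 1))) \<and> \<sigma> 5 = Num 0 \<and>
    \<sigma> 4 = enc_list (map enc_item [Task [] (replicate n 0) s 1 D (1 / 2 ^ q / 2 ^ (Suc j * D))])"
proof -
  let ?loop = "While (Less (Var 2) (Plus (Var 9) (Var 9)))
      [Assign 9 (Half (Var 9)), Assign 10 (Plus (Var 10) (Lit 1)), Assign 13 (halve_expr (Suc j) (Var 13))]"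
  let ?zeros = "While (Less (Lit 0) (Var 12))
      [Assign 11 (MkCell (Lit 0) (Var 11)), Assign 12 (Minus (Var 12) (Lit 1))]"
  let ?task = "MkCell (mk_task (Var 1) (Lit 1) (Var 10) (Var 13) (Lit 0) (Lit 0) (Var 11)) (Lit 0)"
  define \<sigma>0 where "\<sigma>0 = init_store n s \<epsilon>"
  define \<sigma>1 where "\<sigma>1 = \<sigma>0(3 := Num (real (K * (n + s + 1))), 9 := Num (real s), 13 := Num (1 / 2 ^ q))"
  define \<sigma>2 where "\<sigma>2 = \<sigma>1(9 := Num (real s / 2 ^ D), 10 := Num (real D),
    13 := Num (1 / 2 ^ q / 2 ^ (Suc j * D)))"
  define \<sigma>3 where "\<sigma>3 = \<sigma>2(12 := Num (real n))"
  define \<sigma>4 where "\<sigma>4 = \<sigma>3(11 := enc_point (replicate n 0 @ []), 12 := Num 0)"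
  define \<sigma>5 where "\<sigma>5 = \<sigma>4(4 := expr_val ?task \<sigma>4)"
  have regs: "\<sigma>0 0 = Num (real n)" "\<sigma>0 1 = Num (real s)" "\<sigma>0 (Suc 0) = Num (real s)" "\<sigma>0 2 = Num \<epsilon>" "\<sigma>0 5 = Num 0"
    "\<sigma>0 10 = Num 0" "\<sigma>0 11 = Num 0"
    by (simp_all add: \<sigma>0_def init_store_def)
  have "expr_val (mult_expr K (Plus (Plus (Var 0) (Var 1)) (Lit 1))) \<sigma>0 = Num (real (K * (n + s + 1)))"
    by (simp add: expr_val_mult_expr regs algebra_simps)
  moreover have "expr_val (halve_expr q (Lit 1)) \<tau> = Num (1 / 2 ^ q)" for \<tau>
    by (rule expr_val_halve_expr) simp
  ultimately have 1: "exec n g [Assign 3 (mult_expr K (Plus (Plus (Var 0) (Var 1)) (Lit 1))), Assign 9 (Var 1),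
      Assign 13 (halve_expr q (Lit 1))] \<sigma>0 (Suc (Suc (Suc 0))) \<sigma>1"
    using regs by (intro exec_Assign) (simp add: \<sigma>1_def exec_Nil)
  have 2: "exec n g [?loop] \<sigma>1 (4 * (D - 0) + 1) \<sigma>2"
    unfolding \<sigma>2_def by (rule exec_count_depth[OF D]) (simp_all add: \<sigma>1_def regs)
  have 3: "exec n g [Assign 12 (Var 0)] \<sigma>2 (Suc 0) \<sigma>3"
    using regs by (intro exec_Assign) (simp add: \<sigma>3_def \<sigma>2_def \<sigma>1_def exec_Nil)
  have 4: "exec n g [?zeros] \<sigma>3 (3 * n + 1) \<sigma>4"
    unfolding \<sigma>4_def by (rule exec_count_zeros) (simp_all add: \<sigma>3_def \<sigma>2_def \<sigma>1_def regs)
  have 5: "exec n g [Assign 4 ?task] \<sigma>4 (Suc 0) \<sigma>5"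
    unfolding \<sigma>5_def by (rule exec_Assign[OF exec_Nil])
  have "Suc (Suc (Suc 0)) + (4 * (D - 0) + 1 + (Suc 0 + (3 * n + 1 + Suc 0))) = 4 * D + 3 * n + 7"
    by simp
  then have "exec n g (init_code j q K) \<sigma>0 (4 * D + 3 * n + 7) \<sigma>5"
    using exec_append[OF 1 exec_append[OF 2 exec_append[OF 3 exec_append[OF 4 5]]]]
    unfolding init_code_def by (simp only: append_Cons append_Nil)
  moreover have "\<sigma>5 3 = Num (real (K * (n + s + 1)))" "\<sigma>5 5 = Num 0"
    "\<sigma>5 4 = enc_list (map enc_item [Task [] (replicate n 0) s 1 D (1 / 2 ^ q / 2 ^ (Suc j * D))])"
    using regs by (simp_all add: \<sigma>5_def \<sigma>4_def \<sigma>3_def \<sigma>2_def \<sigma>1_def)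
  ultimately show ?thesis
    unfolding \<sigma>0_def by blast
qed

text \<open>\<open>D\<close> is the least depth with \<open>2 * s / 2 ^ D \<le> \<epsilon>\<close>,
  so cut-off nodes use up at most half of \<epsilon>. Minimality bounds \<open>2 ^ D\<close>, which
  keeps both \<open>D\<close> and the smallest tester parameter polynomial.\<close>

lemma ex_depth:
  assumes "0 < \<epsilon>" "\<epsilon> < 1" "1 \<le> s"
  shows "\<exists>D. (\<forall>d. \<epsilon> < 2 * (real s / 2 ^ d) \<longleftrightarrow> d < D) \<and> 2 ^ D \<le> 4 * real s / \<epsilon>"
proof -
  obtain d0 where "2 * real s / \<epsilon> < 2 ^ d0"
    using real_arch_pow[of 2] by auto
  then have exec: "\<not> \<epsilon> < 2 * (real s / 2 ^ d0)"
    using assms by (simp add: field_simps)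
  define D where "D = (LEAST d. \<not> \<epsilon> < 2 * (real s / 2 ^ d))"
  have D: "\<not> \<epsilon> < 2 * (real s / 2 ^ D)"
    unfolding D_def using exec by (rule LeastI)
  have less: "\<epsilon> < 2 * (real s / 2 ^ d)" if "d < D" for d
    using not_less_Least[OF that[unfolded D_def]] by simp
  have "\<not> \<epsilon> < 2 * (real s / 2 ^ d)" if "D \<le> d" for d
  proof -
    have "(2::real) ^ D \<le> 2 ^ d"
      using that by (intro power_increasing) auto
    then have "real s / 2 ^ d \<le> real s / 2 ^ D"
      by (intro divide_left_mono) auto
    then show ?thesis
      using D by linarith
  qed
  moreover have "2 ^ D \<le> 4 * real s / \<epsilon>"
  proof (cases D)
    case 0
    then show ?thesis
      using assms by (simp add: field_simps)
  next
    case (Suc d)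
    then show ?thesis
      using less[of d] assms by (simp add: field_simps)
  qed
  ultimately show ?thesis
    using less by (meson not_less)
qed

text \<open>The choice \<open>\<omega> = 2 * \<delta>\<close> makes the second summand 1/2, and
  \<theta> is the resulting value; it falls short of 1 by
  \<open>2 * (\<delta> - 1 / 2) ^ 2\<close>.\<close>

lemma ex_vote_parameters:
  assumes "0 < \<delta>" "\<delta> < 1 / 2"
  shows "\<exists>\<omega> \<theta> :: real. 0 < \<omega> \<and> \<omega> < 1 \<and> 0 < \<theta> \<and> \<theta> < 1 \<and> (1 - \<delta>) * \<omega> + \<delta> / \<omega> \<le> \<theta>"
proof (rule exI[of _ "2 * \<delta>"], rule exI[of _ "1 / 2 + 2 * \<delta> * (1 - \<delta>)"], intro conjI)
  have "0 < 2 * (\<delta> - 1 / 2) ^ 2"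
    using assms by simp
  then show "1 / 2 + 2 * \<delta> * (1 - \<delta>) < 1"
    by (simp add: power2_eq_square algebra_simps)
  show "0 < 1 / 2 + 2 * \<delta> * (1 - \<delta>)"
    using assms by (intro add_pos_nonneg) auto
qed (use assms in \<open>auto simp: algebra_simps\<close>)

text \<open>A crude exponential bound is enough: with a number of votes linear in
  \<open>n + s\<close> the failure probability of a test decays exponentially too, and the program
  need not compute a logarithm for it. The base is \<open>64 = 8 * 2 ^ 3\<close>, from
  \<open>4 \<le> 8 ^ m\<close> and \<open>m \<le> 2 ^ m\<close> with
  \<open>m = n + s\<close>.\<close>

lemma iterations_bound:
  assumes "1 \<le> s"
  shows "s * (2 * n * s + s + 1) \<le> (64 :: nat) ^ (n + s)"
proof -
  let ?m = "n + s"
  have "s * (2 * n * s + s + 1) \<le> ?m * (2 * ?m * ?m + ?m * ?m + ?m * ?m)"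
  proof (intro mult_mono add_mono)
    show "s \<le> ?m * ?m" "1 \<le> ?m * ?m"
      using assms le_square[of ?m] by linarith+
  qed auto
  also have "\<dots> = 4 * ?m ^ 3"
    by (simp add: power3_eq_cube algebra_simps)
  also have "\<dots> \<le> 8 ^ ?m * (2 ^ ?m) ^ 3"
  proof (intro mult_mono power_mono)
    show "(4::nat) \<le> 8 ^ ?m"
      using assms self_le_power[of "8::nat" ?m] by simp
    show "?m \<le> 2 ^ ?m"
      using less_exp[of ?m] by simp
  qed auto
  also have "\<dots> = 64 ^ ?m"
  proof -
    have "(64 :: nat) ^ ?m = (8 * 2 ^ 3) ^ ?m"
      by simp
    then show ?thesis
      by (simp only: power_mult_distrib power_mult[symmetric] mult.commute[of 3])
  qed
  finally show ?thesis .
qed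

text \<open>One of the \<open>n + s + 1\<close> blocks of \<open>K\<close> votes supplies the factor
  \<open>\<delta> / 4\<close>, each of the others a factor \<open>1 / 64\<close> against the number
  of iterations.\<close>

lemma vote_error_bound:
  fixes \<theta> \<delta> :: real
  assumes "1 \<le> s" "0 < \<theta>" "\<theta> ^ K \<le> \<delta> / 4 * (1 / 64)" "0 < \<delta>" "\<delta> < 1"
    and "W \<le> s * (2 * n * s + s + 1)"
  shows "2 * \<theta> ^ (K * (n + s + 1)) * real W \<le> \<delta> / 2"
proof -
  let ?m = "n + s"
  have "\<theta> ^ (K * (?m + 1)) = \<theta> ^ K * (\<theta> ^ K) ^ ?m"
    by (simp add: power_mult power_add)
  also have "\<dots> \<le> \<delta> / 4 * (1 / 64) ^ ?m"
    using assms by (intro mult_mono power_mono) auto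
  finally have 1: "\<theta> ^ (K * (?m + 1)) \<le> \<delta> / 4 * (1 / 64) ^ ?m" .
  have "real W \<le> real (64 ^ ?m)"
    using order_trans[OF assms(6) iterations_bound[OF assms(1), of n]] by (simp only: of_nat_le_iff)
  then have "\<theta> ^ (K * (?m + 1)) * real W \<le> (\<delta> / 4 * (1 / 64) ^ ?m) * 64 ^ ?m"
    using assms(4) by (intro mult_mono[OF 1]) auto
  then show ?thesis
    by (simp add: power_divide)
qed

theorem theorem5p1:
  fixes c \<delta> :: real and A :: tester
  assumes "c > 0"
    and "0 < \<delta>" and "\<delta> < 1 / 2"
    and "tolerant_tester c \<delta> A"
  shows "\<exists>(B :: instr list) (k :: nat). k > 0 \<and>
    (\<forall>(n :: nat) (s' :: nat) (\<epsilon>' :: real) (g :: point \<Rightarrow> real).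
      0 < \<epsilon>' \<and> \<epsilon>' < 1 \<and> bool_fun n g \<and> computed_by_size n s' g \<longrightarrow>
      (\<exists>t m :: nat. real t \<le> poly_ub k n s' \<epsilon>' \<and> real m \<le> poly_ub k n s' \<epsilon>' \<and>
        runs_in_time A B n s' \<epsilon>' g t \<and>
        calls_bounded A B n s' \<epsilon>' g t m (poly_lb k s' \<epsilon>') \<and>
        measure_pmf.prob (run A B n s' \<epsilon>' g t) {C. outputs_close_tree n \<epsilon>' g C} \<ge> 1 - \<delta>))"
proof -
  \<comment> \<open>At least 1, so that closeness within \<open>p\<close> implies closeness within
    \<open>C * p\<close>; a tester for \<open>c\<close> also serves for any larger constant.\<close>
  define C where "C = max 1 c"
  obtain \<omega> \<theta> where \<omega>: "0 < \<omega>" "\<omega> < 1" "0 < \<theta>" "\<theta> < 1" "(1 - \<delta>) * \<omega> + \<delta> / \<omega> \<le> \<theta>"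
    using ex_vote_parameters[OF assms(2,3)] by blast
  obtain j where j: "2 * C < 2 ^ j"
    using real_arch_pow[of 2] by auto
  \<comment> \<open>\<open>q\<close> pays for the sampling errors: with
    \<open>s / 2 ^ D \<le> 1 / 2\<close> it gives \<open>P * s \<le> \<delta> / 2\<close>.\<close>
  obtain q where "(1 / 2) ^ q < \<delta>"
    using real_arch_pow_inv[of \<delta> "1 / 2"] assms(2) by auto
  then have q: "1 / 2 ^ q \<le> \<delta>"
    by (simp add: power_divide)
  obtain K where K: "\<theta> ^ K < \<delta> / 4 * (1 / 64)"
    using real_arch_pow_inv[of "\<delta> / 4 * (1 / 64)" \<theta>] \<omega> assms(2) by auto
  \<comment> \<open>The first two summands dominate the running time and the number of calls; the
    others supply the exponent and the coefficient of the lower bound on the tester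
    parameter.\<close>
  define k where "k = 32 * K + 158 + Suc j + 2 ^ q * 4 ^ Suc j"
  define B where "B = learner_code j q K"
  have "\<exists>t m :: nat. real t \<le> poly_ub k n s \<epsilon> \<and> real m \<le> poly_ub k n s \<epsilon> \<and>
        runs_in_time A B n s \<epsilon> g t \<and> calls_bounded A B n s \<epsilon> g t m (poly_lb k s \<epsilon>) \<and>
        measure_pmf.prob (run A B n s \<epsilon> g t) {C. outputs_close_tree n \<epsilon> g C} \<ge> 1 - \<delta>"
    if \<epsilon>: "0 < \<epsilon>" "\<epsilon> < 1" and g: "bool_fun n g" "computed_by_size n s g" for n s \<epsilon> g
  proof -
    obtain T0 where T0: "wf_dtree n T0" "num_leaves T0 \<le> s" "\<And>x. x \<in> cube n \<Longrightarrow> g x = dt_eval T0 x"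
      using g(2) by (auto simp: computed_by_size_def dtrees_def)
    then have s: "1 \<le> s"
      using num_leaves_pos[of T0] by linarith
    obtain D where D: "\<And>d. \<epsilon> < 2 * (real s / 2 ^ d) \<longleftrightarrow> d < D" "2 ^ D \<le> 4 * real s / \<epsilon>"
      using ex_depth[OF \<epsilon> s] by blast
    define p0 where "p0 = (1 / 2 ^ q / 2 ^ (Suc j * D) :: real)"
    define P where "P = (1 / 2 ^ q / 2 ^ D :: real)"
    define R where "R = K * (n + s + 1)"
    define W where "W = s * (2 * n * s + s + 1)"
    define V where "V = 6 * W + 1"
    define m where "m = 2 * R * W"
    \<comment> \<open>One bound has to serve for the run, the output size and each answered query,
      so all three are added.\<close>
    define t where "t = 4 * D + 3 * n + 7 + (W * (8 * R + 12 * n + 22) + 2) + V + 8 * n + 5"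
    have half: "2 * (real s / 2 ^ D) \<le> \<epsilon>"
      using D(1)[of D] by simp
    have P_bounds: "0 < P" "P * real s \<le> \<delta> / 2" "P \<le> \<epsilon> / 2" "P < 1"
    proof -
      show "0 < P"
        by (simp add: P_def)
      have *: "P * real s = 1 / 2 ^ q * (real s / 2 ^ D)"
        by (simp add: P_def)
      have "real s / 2 ^ D \<le> 1 / 2"
        using half \<epsilon> by linarith
      then have "1 / 2 ^ q * (real s / 2 ^ D) \<le> \<delta> * (1 / 2)"
        using assms(2) by (intro mult_mono q) auto
      then show "P * real s \<le> \<delta> / 2"
        using * by simp
      have "real s / 2 ^ D \<le> \<epsilon> / 2"
        using half by linarith
      then have "1 / 2 ^ q * (real s / 2 ^ D) \<le> 1 * (\<epsilon> / 2)"
        by (intro mult_mono) auto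
      moreover have "P * 1 \<le> P * real s"
        using s \<open>0 < P\<close> by (intro mult_left_mono) auto
      ultimately show "P \<le> \<epsilon> / 2"
        using * by linarith
      then show "P < 1"
        using \<epsilon> by simp
    qed
    have test: "pmf (A n u p f) True \<ge> 1 - \<delta>" if "0 < p" "p < 1" "bool_fun n f" "tree_close n u p f" for u p f
      using assms(4) that unfolding tolerant_tester_def tree_close_def by blast
    have test': "pmf (A n u p f) False \<ge> 1 - \<delta>"
      if "0 < p" "p < 1" "bool_fun n f" "\<not> tree_close n u (C * p) f" for u p f
    proof -
      have "c * p \<le> C * p"
        using that by (simp add: C_def)
      then have "\<not> tree_close n u (c * p) f"
        using that(4) tree_close_mono by blast
      then show ?thesis
        using assms(4) that unfolding tolerant_tester_def tree_close_def by blast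
    qed
    interpret learner A n g s R j V m \<epsilon> C \<delta> \<omega> \<theta> p0 P
    proof
      show "1 \<le> C"
        by (simp add: C_def)
    qed (use g test test' \<omega> P_bounds j in \<open>auto simp: p0_def\<close>)
    define w where "w = Task [] (replicate n 0) s 1 D p0"
    have weight: "weight w \<le> W"
    proof -
      obtain s0 where s0: "s = Suc s0"
        using s by (cases s) auto
      have "weight w = (s - 1) * (2 * n * s + s + 1) + n * s + (s - 1) + 1"
        by (simp add: w_def max_weight_def)
      also have "\<dots> \<le> W"
        by (simp add: W_def s0 algebra_simps)
      finally show ?thesis .
    qed
    obtain \<sigma> where \<sigma>: "exec n g (init_code j q K) (init_store n s \<epsilon>) (4 * D + 3 * n + 7) \<sigma>"
      "\<sigma> 3 = Num (real R)" "\<sigma> 5 = Num 0" "\<sigma> 4 = enc_list (map enc_item [w])"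
      using exec_init[OF D(1), of n g j q K] by (auto simp: R_def w_def p0_def)
    have zeros: "replicate n 0 \<in> restrictions n"
      by (auto simp: restrictions_def)
    have "p0 * 2 ^ (j * D) = P"
      by (simp add: p0_def P_def power_add)
    then have "safe_item w"
      using zeros s by (simp add: w_def)
    moreover have "2 * R * weight w \<le> m"
      unfolding m_def using weight by (rule mult_le_mono2)
    moreover have "vsize (\<sigma> 5) + 6 * weight w \<le> V"
      using \<sigma> weight by (simp add: V_def)
    ultimately have invariant: "invariant [w] \<sigma> []"
      using \<sigma> unfolding invariant_def by simp
    have fill: "fill (replicate n 0) x = x" if "x \<in> cube n" for x
      using that by (simp add: fill_zeros length_cube)
    have "good \<sigma> [w]"
      unfolding good_def
    proof (intro conjI exI[of _ "[]"])
      \<comment> \<open>\<open>g\<close> is itself a tree of size \<open>s\<close>, so the root task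
        starts at distance 0.\<close>
      have "cube_prob n (\<lambda>x. restr (replicate n 0) x \<noteq> dt_eval T0 x) = cube_prob n (\<lambda>x. False)"
        by (rule cube_prob_cong) (simp add: fill T0(3))
      then have "close n (p0 / 2) (restr (replicate n 0)) (dt_eval T0)"
        by (simp add: close_iff_cube_prob cube_prob_eq_sum p0_def)
      then have "tree_close n s (p0 / 2) (restr (replicate n 0))"
        using T0 by (auto simp: tree_close_def dtrees_def)
      then show "\<forall>w\<in>set [w]. good_item w"
        by (simp add: w_def viable_def)
      have "close n \<epsilon> (dt_eval T) g" if "achieves (replicate n 0) s D T" for T
      proof -
        have "cube_prob n (\<lambda>x. dt_eval T x \<noteq> g x) =
            cube_prob n (\<lambda>x. dt_eval T (fill (replicate n 0) x) \<noteq> g (fill (replicate n 0) x))"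
          by (rule cube_prob_cong) (simp add: fill)
        then show ?thesis
          using that half P_bounds(3) by (simp add: achieves_def close_iff_cube_prob)
      qed
      then show "completes [w] []"
        by (auto simp: w_def achieves_def)
    qed (simp add: \<sigma>)
    then have "bound \<sigma> [w] = 2 * \<theta> ^ R * real (weight w) + P * real s"
      by (simp add: bound_def budget_def w_def)
    also have "\<dots> \<le> \<delta>"
      using vote_error_bound[OF s \<omega>(3) less_imp_le[OF K] assms(2) _ weight[unfolded W_def]] assms(3) P_bounds(2)
      by (simp add: R_def)
    finally have bound: "bound \<sigma> [w] \<le> \<delta>" .
    have "ensures (W * iteration_time + 2) \<delta>
        ([While (IsCell (Var 4)) (body_code j), Assign 0 (Head (Var 5))], \<sigma>, [])"
      by (rule ensures_mono[OF ensures_loop[OF invariant] _ bound]) (use weight in simp)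
    then have "ensures t \<delta> (init_code j q K @ [While (IsCell (Var 4)) (body_code j), Assign 0 (Head (Var 5))],
        init_store n s \<epsilon>, [])"
      by (intro ensures_exec[OF \<sigma>(1)]) (auto simp: t_def iteration_time_def elim: ensures_mono)
    then have run: "set_pmf (run A B n s \<epsilon> g t) \<subseteq> safe" "measure_pmf.prob (run A B n s \<epsilon> g t) bad \<le> \<delta>"
      by (auto simp: ensures_def run_def steps_def B_def learner_code_def)
    define x where "x = real n + real s + 1 / \<epsilon>"
    have "1 \<le> 1 / \<epsilon>"
      using \<epsilon> by simp
    then have x: "real n + real s + 1 \<le> x" "1 / \<epsilon> \<le> x" "2 \<le> x"
      using s unfolding x_def by linarith+
    have kx: "a * x ^ 4 \<le> poly_ub k n s \<epsilon>" if "a \<le> real k" "0 \<le> a" for a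
      using that x unfolding poly_ub_def x_def[symmetric]
      by (intro mult_mono power_increasing) (auto simp: k_def)
    have Rx: "real R \<le> real K * x"
      unfolding R_def of_nat_mult of_nat_add using x(1) by (intro mult_left_mono) auto
    have Wx: "real W \<le> 4 * x ^ 3"
    proof -
      have "1 * x \<le> x * x"
        using x by (intro mult_right_mono) auto
      then have "real s \<le> x * x" "1 \<le> x * x"
        using x(1,3) by linarith+
      then have "real W \<le> x * (2 * x * x + x * x + x * x)"
        unfolding W_def of_nat_mult of_nat_add using x by (intro mult_mono add_mono) auto
      then show ?thesis
        by (simp add: power3_eq_cube)
    qed
    have Dx: "real D \<le> 4 * x ^ 2"
    proof -
      have "real D \<le> 2 ^ D"
        using of_nat_less_two_power[of D, where 'a = real] by simp
      also have "\<dots> \<le> 4 * (real s * (1 / \<epsilon>))"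
        using D(2) by simp
      also have "\<dots> \<le> 4 * (x * x)"
        using x \<epsilon> by (intro mult_left_mono mult_mono) auto
      finally show ?thesis
        by (simp add: power2_eq_square)
    qed
    have mx: "real m \<le> poly_ub k n s \<epsilon>"
    proof -
      have "real m \<le> 2 * (real K * x) * (4 * x ^ 3)"
        unfolding m_def of_nat_mult using Rx Wx x by (intro mult_mono) auto
      also have "\<dots> = real (8 * K) * x ^ 4"
        by (simp add: power3_eq_cube power4_eq_xxxx)
      also have "\<dots> \<le> poly_ub k n s \<epsilon>"
        by (rule kx) (auto simp: k_def)
      finally show ?thesis .
    qed
    have tx: "real t \<le> poly_ub k n s \<epsilon>"
    proof -
      have pow: "x ^ i \<le> x ^ 4" if "i \<le> 4" for i
        using that x by (intro power_increasing) auto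
      have "8 * real R + 12 * real n + 22 \<le> (8 * real K + 23) * x"
        using Rx x by (simp add: algebra_simps)
      then have "real W * (8 * real R + 12 * real n + 22) \<le> 4 * x ^ 3 * ((8 * real K + 23) * x)"
        using Wx x by (intro mult_mono) auto
      also have "\<dots> = (32 * real K + 92) * x ^ 4"
        by (simp add: power3_eq_cube power4_eq_xxxx algebra_simps)
      finally have "real t \<le> (32 * real K + 92) * x ^ 4 + 16 * x ^ 2 + 11 * x + 24 * x ^ 3 + 15 * x ^ 0"
        using Dx Wx x unfolding t_def V_def by simp
      also have "\<dots> \<le> (32 * real K + 92) * x ^ 4 + 16 * x ^ 4 + 11 * x ^ 4 + 24 * x ^ 4 + 15 * x ^ 4"
        using pow[of 2] pow[of 1] pow[of 3] pow[of 0] by (intro add_mono) auto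
      also have "\<dots> = real (32 * K + 158) * x ^ 4"
        by (simp add: algebra_simps)
      also have "\<dots> \<le> poly_ub k n s \<epsilon>"
        by (rule kx) (auto simp: k_def)
      finally show ?thesis .
    qed
    have p0: "poly_lb k s \<epsilon> \<le> p0"
    proof -
      let ?y = "1 / real s * \<epsilon>"
      have "?y * 2 ^ D \<le> 4"
        using D(2) s \<epsilon> by (simp add: field_simps)
      then have "(?y * 2 ^ D) ^ Suc j \<le> 4 ^ Suc j"
        using \<epsilon> by (intro power_mono) auto
      then have "?y ^ Suc j * 2 ^ (Suc j * D) \<le> 4 ^ Suc j"
        by (simp only: power_mult_distrib power_mult[symmetric] mult.commute[of D])
      moreover have "1 / (a * b) * u \<le> 1 / a / v" if "u * v \<le> b" "0 < a" "0 < b" "0 < v" for a b u v :: real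
        using that by (simp add: field_simps)
      ultimately have 1: "1 / (2 ^ q * 4 ^ Suc j) * ?y ^ Suc j \<le> p0"
        unfolding p0_def by (simp only: zero_less_power zero_less_numeral)
      have "?y ^ k \<le> ?y ^ Suc j"
        using \<epsilon> s by (intro power_decreasing) (auto simp: k_def field_simps)
      moreover have "real (2 ^ q * 4 ^ Suc j) \<le> real k"
        by (simp only: of_nat_le_iff) (simp add: k_def)
      then have "1 / real k \<le> 1 / (2 ^ q * 4 ^ Suc j)"
        by (intro frac_le) auto
      ultimately have "1 / real k * ?y ^ k \<le> 1 / (2 ^ q * 4 ^ Suc j) * ?y ^ Suc j"
        using \<epsilon> by (intro mult_mono) auto
      then show ?thesis
        using 1 unfolding poly_lb_def by linarith
    qed
    have "runs_in_time A B n s \<epsilon> g t"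
      unfolding runs_in_time_def using run(1) by (fastforce simp: safe_def ok_call_def t_def)
    moreover have "calls_bounded A B n s \<epsilon> g t m (poly_lb k s \<epsilon>)"
      unfolding calls_bounded_def using run(1) p0 by (fastforce simp: safe_def ok_call_def)
    moreover have "{C. outputs_close_tree n \<epsilon> g C} = UNIV - bad"
      by (auto simp: bad_def)
    then have "measure_pmf.prob (run A B n s \<epsilon> g t) {C. outputs_close_tree n \<epsilon> g C} \<ge> 1 - \<delta>"
      using run(2) measure_pmf.prob_compl[of bad "run A B n s \<epsilon> g t"] by simp
    ultimately show ?thesis
      using tx mx by blast
  qed
  moreover have "k > 0"
    by (simp add: k_def)
  ultimately show ?thesis
    by blast
qed

end
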